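(* Let $\lambda$ be a partition with $d=\ell(\lambda)$ parts and $\mu$ a partition with $[\mu]\subseteq[\lambda]$. Then $$f^{\lambda/\mu}=\frac{|\lambda/\mu|!}{\prod_{u\in[\lambda]}h(u)}\sum_{T\in\mathcal{SF}(\lambda/\mu)}\ \prod_{(j,t)\in M(T)}\bigl(\lambda_t-t+i(j,t)-j+1\bigr).$$
   Context: $f^{\lambda/\mu}$ is the number of standard Young tableaux of shape $\lambda/\mu$; $h(u)$ is the hook length of $u$ in $\lambda$; primes denote conjugate partitions. $\mathcal{SF}(\lambda/\mu)$ is the set of semistandard Young tableaux $T$ of skew shape $\lambda/\mu$ (positive integer entries, rows weakly and columns strictly increasing) with $T(i,j)\le i$ for all $(i,j)\in[\lambda/\mu]$. For $T\in\mathcal{SF}(\lambda/\mu)$, $M(T)$ is the set of pairs $(j,t)$ with $1\le j\le\ell(\lambda')$ and $1\le t\le\lambda'_j$ such that there is no $i$ with $T(i,j)=t$. For $(j,t)\in M(T)$, $i(j,t)$ is the unique integer $i$ with $\mu'_j\le i\le\lambda'_j$ such that $T(i',j)<t$ for all $i'\le i$ and $T(i',j)>t$ for all $i'>i$ (where $(i',j)$ ranges over cells of $[\lambda/\mu]$ in column $j$). *)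

theory Defs
  imports Complex_Main "HOL-Library.FuncSet"
begin

text \<open>
  A partition is the list of its (positive) parts in weakly decreasing order, so that its
  number of parts is the \<open>length\<close> of the list.
\<close>

definition is_partition :: "nat list \<Rightarrow> bool" where
  "is_partition la \<longleftrightarrow> sorted_wrt (\<ge>) la \<and> 0 \<notin> set la"

text \<open>
  Parts, rows and columns are indexed from 1, and \<open>part la i = 0\<close> beyond the last part
  (and for the junk index 0).
\<close>

definition part :: "nat list \<Rightarrow> nat \<Rightarrow> nat" where
  "part la i = (if 1 \<le> i \<and> i \<le> length la then la ! (i - 1) else 0)"

definition conj_partition :: "nat list \<Rightarrow> nat list" where
  "conj_partition la = map (\<lambda>j. card {i. 1 \<le> i \<and> i \<le> length la \<and> j \<le> part la i}) [1..<Suc (part la 1)]"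

definition diagram :: "nat list \<Rightarrow> (nat \<times> nat) set" where
  "diagram la = {(i, j). 1 \<le> i \<and> i \<le> length la \<and> 1 \<le> j \<and> j \<le> part la i}"

definition skew_diagram :: "nat list \<Rightarrow> nat list \<Rightarrow> (nat \<times> nat) set" where
  "skew_diagram la mu = diagram la - diagram mu"

definition hook :: "nat list \<Rightarrow> nat \<times> nat \<Rightarrow> (nat \<times> nat) set" where
  "hook la = (\<lambda>(i, j). {(a, b) \<in> diagram la. (a = i \<and> j \<le> b) \<or> (b = j \<and> i \<le> a)})"

definition hook_length :: "nat list \<Rightarrow> nat \<times> nat \<Rightarrow> nat" where
  "hook_length la u = card (hook la u)"

definition rows_weakly_increasing :: "(nat \<times> nat) set \<Rightarrow> (nat \<times> nat \<Rightarrow> nat) \<Rightarrow> bool" where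
  "rows_weakly_increasing D T \<longleftrightarrow>
     (\<forall>i j j'. (i, j) \<in> D \<longrightarrow> (i, j') \<in> D \<longrightarrow> j < j' \<longrightarrow> T (i, j) \<le> T (i, j'))"

definition rows_strictly_increasing :: "(nat \<times> nat) set \<Rightarrow> (nat \<times> nat \<Rightarrow> nat) \<Rightarrow> bool" where
  "rows_strictly_increasing D T \<longleftrightarrow>
     (\<forall>i j j'. (i, j) \<in> D \<longrightarrow> (i, j') \<in> D \<longrightarrow> j < j' \<longrightarrow> T (i, j) < T (i, j'))"

definition cols_strictly_increasing :: "(nat \<times> nat) set \<Rightarrow> (nat \<times> nat \<Rightarrow> nat) \<Rightarrow> bool" where
  "cols_strictly_increasing D T \<longleftrightarrow>
     (\<forall>i i' j. (i, j) \<in> D \<longrightarrow> (i', j) \<in> D \<longrightarrow> i < i' \<longrightarrow> T (i, j) < T (i', j))"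

text \<open>
  Fillings of a shape are extensional functions on its cells, so that every tableau is
  represented by exactly one HOL function and sets of tableaux can be counted and summed over.
\<close>

definition SYT :: "nat list \<Rightarrow> nat list \<Rightarrow> (nat \<times> nat \<Rightarrow> nat) set" where
  "SYT la mu =
     {T \<in> skew_diagram la mu \<rightarrow>\<^sub>E {1..card (skew_diagram la mu)}.
        bij_betw T (skew_diagram la mu) {1..card (skew_diagram la mu)} \<and>
        rows_strictly_increasing (skew_diagram la mu) T \<and>
        cols_strictly_increasing (skew_diagram la mu) T}"

definition num_SYT :: "nat list \<Rightarrow> nat list \<Rightarrow> nat" where
  "num_SYT la mu = card (SYT la mu)"

definition SSYT :: "nat list \<Rightarrow> nat list \<Rightarrow> (nat \<times> nat \<Rightarrow> nat) set" where
  "SSYT la mu =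
     {T \<in> skew_diagram la mu \<rightarrow>\<^sub>E {1..}.
        rows_weakly_increasing (skew_diagram la mu) T \<and>
        cols_strictly_increasing (skew_diagram la mu) T}"

definition SF :: "nat list \<Rightarrow> nat list \<Rightarrow> (nat \<times> nat \<Rightarrow> nat) set" where
  "SF la mu = {T \<in> SSYT la mu. \<forall>(i, j) \<in> skew_diagram la mu. T (i, j) \<le> i}"

definition missing :: "nat list \<Rightarrow> nat list \<Rightarrow> (nat \<times> nat \<Rightarrow> nat) \<Rightarrow> (nat \<times> nat) set" where
  "missing la mu T =
     {(j, t). 1 \<le> j \<and> j \<le> length (conj_partition la) \<and>
              1 \<le> t \<and> t \<le> part (conj_partition la) j \<and>
              \<not> (\<exists>i. (i, j) \<in> skew_diagram la mu \<and> T (i, j) = t)}"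

text \<open>
  For \<open>(j, t) \<in> missing la mu T\<close>, the row after which \<open>t\<close> would be inserted in column \<open>j\<close>.
\<close>

definition insertion_row ::
    "nat list \<Rightarrow> nat list \<Rightarrow> (nat \<times> nat \<Rightarrow> nat) \<Rightarrow> nat \<Rightarrow> nat \<Rightarrow> nat" where
  "insertion_row la mu T j t =
     (THE i. part (conj_partition mu) j \<le> i \<and> i \<le> part (conj_partition la) j \<and>
             (\<forall>i'. (i', j) \<in> skew_diagram la mu \<longrightarrow>
                (i' \<le> i \<longrightarrow> T (i', j) < t) \<and> (i < i' \<longrightarrow> t < T (i', j))))"

end

theory Submission
  imports Defs
begin

text \<open>
  The right-hand sum, as a function of the inner shape, is a shifted Schur function evaluated at
  the outer shape, and the formula expresses that shifted Schur functions and numbers of standard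
  tableaux obey the same recursion over the inner shape.
  
  Write \<open>p\<close> for the row lengths of \<open>la\<close> and \<open>q\<close> for those of \<open>mu\<close>, and let \<open>S p q\<close> be
  \<open>shifted_schur n p q\<close>. It is defined by branching in the number \<open>n\<close> of variables: strip a
  horizontal strip off \<open>q\<close>, pay \<open>p 0 + i - j\<close> for each cell \<open>(i, j)\<close> of the strip, and continue with
  the variables \<open>p 1, p 2, \<dots>\<close>. Three facts carry the proof.
  
  \<^item> Pieri rule (\<open>shifted_schur_pieri\<close>): the sum of \<open>S p q'\<close> over all \<open>q'\<close> obtained from \<open>q\<close> by adding
    one cell is \<open>(|p| - |q|) * S p q\<close>. By induction on \<open>n\<close> it reduces to an identity between the
    weights of single branching steps, \<open>branching_weight_exchange\<close>: add a cell and then remove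
    a strip, or remove a strip and then add a cell.
  
  \<^item> Vanishing (\<open>shifted_schur_vanishing\<close>): \<open>S p q = 0\<close> unless \<open>q\<close> is contained in \<open>p\<close>, so in the Pieri
    rule only the shapes inside \<open>p\<close> remain.
  
  \<^item> Tableau expansion (\<open>sum_tableau_weight_eq_shifted_schur\<close>): the sum over flagged tableaux equals
    \<open>S p q\<close>. Cutting the smallest entry out of a tableau of shape \<open>p/q\<close>, together with the first row
    of \<open>p\<close>, leaves a tableau whose inner shape is \<open>q\<close> minus a horizontal strip; the missing entries with
    the smallest value are exactly the cells of that strip, with matching weights.
  
  Removing the cell that contains 1 from a standard tableau shows that their number is the sum of the
  numbers for all inner shapes with one more cell. Comparison with the Pieri rule and induction on the
  size of \<open>p/q\<close> give \<open>f(p/q) * S p p = |p/q|! * S p q\<close>. For \<open>q = p\<close> the only tableau is the empty one,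
  every entry is missing, and its weight is the product of the hook lengths; hence \<open>S p p\<close> is that
  product. All of this uses row-length functions with rows, columns and entries counted from 0; the
  last part translates to partitions given by lists and indices starting from 1.
\<close>

section \<open>Shapes and horizontal strips\<close>

text \<open>
  A partition is represented by its row lengths as a function on all of the natural numbers, so that
  shapes with different numbers of rows have the same type and row-wise changes are function updates.
\<close>

definition shape :: "nat \<Rightarrow> (nat \<Rightarrow> nat) \<Rightarrow> bool" where
  "shape n q \<longleftrightarrow> antimono q \<and> (\<forall>i\<ge>n. q i = 0)"

definition add_box :: "(nat \<Rightarrow> nat) \<Rightarrow> nat \<Rightarrow> nat \<Rightarrow> nat" where
  "add_box q j = q(j := Suc (q j))"

text \<open>
  The \<open>r\<close> for which \<open>q/r\<close> is a horizontal strip, where \<open>q\<close> has at most \<open>n + 1\<close> and \<open>r\<close> at most \<open>n\<close> rows.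
\<close>

definition interlacing :: "nat \<Rightarrow> (nat \<Rightarrow> nat) \<Rightarrow> (nat \<Rightarrow> nat) set" where
  "interlacing n q = {r. (\<forall>i<n. q (Suc i) \<le> r i \<and> r i \<le> q i) \<and> (\<forall>i\<ge>n. r i = 0)}"

definition strip_weight :: "nat \<Rightarrow> nat \<Rightarrow> (nat \<Rightarrow> nat) \<Rightarrow> (nat \<Rightarrow> nat) \<Rightarrow> int" where
  "strip_weight n x q r = (\<Prod>i\<le>n. \<Prod>j\<in>{r i..<q i}. int x + int i - int j)"

text \<open>
  The shifted Schur function of Okounkov and Olshanski in the \<open>n\<close> variables \<open>p 0, \<dots>, p (n - 1)\<close>, given
  by its branching rule. It is meaningful for every \<open>q\<close> with at most \<open>n\<close> rows, contained in \<open>p\<close> or not.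
\<close>

primrec shifted_schur :: "nat \<Rightarrow> (nat \<Rightarrow> nat) \<Rightarrow> (nat \<Rightarrow> nat) \<Rightarrow> int" where
  "shifted_schur 0 p q = 1"
| "shifted_schur (Suc n) p q =
     (\<Sum>r\<in>interlacing n q. strip_weight n (p 0) q r * shifted_schur n (\<lambda>i. p (Suc i)) r)"

lemma shapeI:
  assumes "\<And>i. q (Suc i) \<le> q i" "\<And>i. n \<le> i \<Longrightarrow> q i = 0"
  shows "shape n q"
  using assms by (auto simp: shape_def antimono_iff_le_Suc)

lemma shape_Suc_le: "shape n q \<Longrightarrow> q (Suc i) \<le> q i"
  by (simp add: shape_def antimono_iff_le_Suc)

lemma shape_le: "shape n q \<Longrightarrow> i \<le> j \<Longrightarrow> q j \<le> q i"
  by (auto simp: shape_def dest: antimonoD)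

lemma shape_zero: "shape n q \<Longrightarrow> n \<le> i \<Longrightarrow> q i = 0"
  by (simp add: shape_def)

lemma shape_tail: "shape (Suc n) q \<Longrightarrow> shape n (\<lambda>i. q (Suc i))"
  by (rule shapeI) (auto simp: shape_Suc_le shape_zero)

lemma interlacing_shape:
  assumes "r \<in> interlacing n q"
  shows "shape n r"
proof (rule shapeI)
  fix i
  show "r (Suc i) \<le> r i"
  proof (cases "Suc i < n")
    case True
    then have "r (Suc i) \<le> q (Suc i)" "q (Suc i) \<le> r i"
      using assms by (auto simp: interlacing_def)
    then show ?thesis by simp
  next
    case False
    then show ?thesis using assms by (auto simp: interlacing_def)
  qed
qed (use assms in \<open>auto simp: interlacing_def\<close>)

lemma shape_add_box_iff:
  assumes "shape n q" "j < n"
  shows "shape n (add_box q j) \<longleftrightarrow> j = 0 \<or> q j < q (j - 1)"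
proof
  assume "shape n (add_box q j)"
  from shape_Suc_le[OF this, of "j - 1"] show "j = 0 \<or> q j < q (j - 1)"
    by (cases j) (auto simp: add_box_def)
next
  assume a: "j = 0 \<or> q j < q (j - 1)"
  show "shape n (add_box q j)"
  proof (rule shapeI)
    fix i
    show "add_box q j (Suc i) \<le> add_box q j i"
      using a shape_Suc_le[OF assms(1), of i] by (auto simp: add_box_def)
  qed (use assms in \<open>auto simp: add_box_def shape_zero\<close>)
qed

lemma finite_bounded_shapes: "finite {r. shape n r \<and> r 0 \<le> b}"
proof (rule finite_subset)
  show "{r. shape n r \<and> r 0 \<le> b} \<subseteq>
    {r. \<forall>i. (i \<in> {..<n} \<longrightarrow> r i \<in> {..b}) \<and> (i \<notin> {..<n} \<longrightarrow> r i = 0)}"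
    using shape_le[of n _ 0] by (auto simp: shape_zero intro: order_trans)
  show "finite {r. \<forall>i. (i \<in> {..<n} \<longrightarrow> r i \<in> {..b}) \<and> (i \<notin> {..<n} \<longrightarrow> r i = (0::nat))}"
    by (rule finite_set_of_finite_funs) auto
qed

lemma interlacing_first_le: "r \<in> interlacing n q \<Longrightarrow> r 0 \<le> q 0"
  by (cases n) (auto simp: interlacing_def)

lemma finite_interlacing: "finite (interlacing n q)"
  by (rule finite_subset[OF _ finite_bounded_shapes[of n "q 0"]])
    (auto simp: interlacing_shape interlacing_first_le)

lemma strip_weight_change_row:
  assumes "j \<le> n"
    and "\<And>i. i \<noteq> j \<Longrightarrow> q' i = q i \<and> r' i = r i"
    and "(\<Prod>c\<in>{r' j..<q' j}. int x + int j - int c) =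
      f * (\<Prod>c\<in>{r j..<q j}. int x + int j - int c)"
  shows "strip_weight n x q' r' = f * strip_weight n x q r"
proof -
  have "strip_weight n x q r = (\<Prod>c\<in>{r j..<q j}. int x + int j - int c) *
      (\<Prod>i\<in>{..n} - {j}. \<Prod>c\<in>{r i..<q i}. int x + int i - int c)" for q r
    unfolding strip_weight_def using assms(1) by (subst prod.remove[of _ j]) auto
  then show ?thesis
    using assms(2,3) by (simp add: mult.assoc)
qed

lemma strip_weight_add_outer:
  assumes "j \<le> n" "r j \<le> q j"
  shows "strip_weight n x (add_box q j) r = (int x + int j - int (q j)) * strip_weight n x q r"
proof (rule strip_weight_change_row[of j])
  have "{r j..<Suc (q j)} = insert (q j) {r j..<q j}" using assms by auto
  then show "(\<Prod>c\<in>{r j..<add_box q j j}. int x + int j - int c) =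
      (int x + int j - int (q j)) * (\<Prod>c\<in>{r j..<q j}. int x + int j - int c)"
    by (simp add: add_box_def)
qed (use assms in \<open>auto simp: add_box_def\<close>)

lemma strip_weight_remove_inner:
  assumes "j \<le> n" "0 < r j" "r j \<le> q j"
  shows "strip_weight n x q (r(j := r j - 1)) =
    (int x + int j - int (r j) + 1) * strip_weight n x q r"
proof (rule strip_weight_change_row[of j])
  obtain k where k: "r j = Suc k" using assms by (cases "r j") auto
  then have "{k..<q j} = insert k {r j..<q j}" using assms by auto
  then show "(\<Prod>c\<in>{(r(j := r j - 1)) j..<q j}. int x + int j - int c) =
      (int x + int j - int (r j) + 1) * (\<Prod>c\<in>{r j..<q j}. int x + int j - int c)"
    using k by simp
qed (use assms in auto)

text \<open>
  Lengthening row \<open>j\<close> of \<open>q\<close> and shortening row \<open>j\<close> of \<open>r\<close> both make the two rows equally long, so the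
  strip has no cell there.
\<close>

lemma strip_weight_empty_row:
  assumes "j \<le> n" "r j = Suc (q j)"
  shows "strip_weight n x (add_box q j) r = strip_weight n x q (r(j := r j - 1))"
  using strip_weight_change_row[of j n "add_box q j" q r "r(j := r j - 1)" x 1] assms
  by (auto simp: add_box_def)

section \<open>The Pieri rule and vanishing\<close>

text \<open>
  Extending the weight by 0 beyond the interlacing shapes lets sums for different \<open>q\<close> run over one common
  index set.
\<close>

definition branching_weight :: "nat \<Rightarrow> nat \<Rightarrow> (nat \<Rightarrow> nat) \<Rightarrow> (nat \<Rightarrow> nat) \<Rightarrow> int" where
  "branching_weight n x q r = (if r \<in> interlacing n q then strip_weight n x q r else 0)"

text \<open>
  When \<open>q/r\<close> is a horizontal strip, every weight in the identity is 0 or a linear factor times the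
  weight of \<open>q/r\<close>. A cell can be added to row \<open>j + 1\<close> of \<open>q\<close> precisely if one can be removed from row \<open>j\<close> of \<open>r\<close>, namely
  if \<open>q (j + 1) < r j\<close>. The two factors differ by \<open>r j - q (j + 1)\<close>, a difference that is 0 when the
  condition fails, so the differences add up over all \<open>j\<close> without side conditions. Row 0 of \<open>q\<close> has no
  partner and accounts for the term \<open>x - q 0\<close>.
\<close>

lemma branching_weight_exchange_interlacing:
  assumes q: "shape (Suc n) q" and r: "r \<in> interlacing n q"
  shows "(\<Sum>j | j < Suc n \<and> shape (Suc n) (add_box q j). branching_weight n x (add_box q j) r) =
    (\<Sum>j | j < n \<and> 0 < r j. branching_weight n x q (r(j := r j - 1))) +
    (int x - (\<Sum>i<Suc n. int (q i)) + (\<Sum>i<n. int (r i))) * branching_weight n x q r"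
proof -
  let ?w = "strip_weight n x q r"
  have r1: "q (Suc i) \<le> r i" "r i \<le> q i" if "i < n" for i
    using r that by (auto simp: interlacing_def)
  have r0: "r i = 0" if "n \<le> i" for i
    using r that by (auto simp: interlacing_def)
  have rq: "r i \<le> q i" for i using r1 r0 by (cases "i < n") auto
  have outer: "branching_weight n x (add_box q j) r =
      (if j = 0 \<or> q j < r (j - 1) then (int x + int j - int (q j)) * ?w else 0)" if "j \<le> n" for j
  proof -
    have "r \<in> interlacing n (add_box q j) \<longleftrightarrow> j = 0 \<or> q j < r (j - 1)"
    proof
      assume a: "r \<in> interlacing n (add_box q j)"
      show "j = 0 \<or> q j < r (j - 1)"
      proof (cases j)
        case (Suc k)
        then have "add_box q j (Suc k) \<le> r k" using a that by (auto simp: interlacing_def)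
        then show ?thesis using Suc by (auto simp: add_box_def)
      qed simp
    next
      assume "j = 0 \<or> q j < r (j - 1)"
      then show "r \<in> interlacing n (add_box q j)"
        using r by (cases j) (auto simp: interlacing_def add_box_def intro: le_SucI)
    qed
    then show ?thesis
      using that rq by (simp add: branching_weight_def strip_weight_add_outer)
  qed
  have inner: "branching_weight n x q (r(j := r j - 1)) =
      (if q (Suc j) < r j then (int x + int j - int (r j) + 1) * ?w else 0)" if "j < n" "0 < r j" for j
  proof -
    have "r(j := r j - 1) \<in> interlacing n q \<longleftrightarrow> q (Suc j) < r j"
      using r that by (fastforce simp: interlacing_def)
    then show ?thesis
      using strip_weight_remove_inner[of j n r q x] that rq by (simp add: branching_weight_def)
  qed
  have "(\<Sum>j | j < Suc n \<and> shape (Suc n) (add_box q j). branching_weight n x (add_box q j) r) =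
      (\<Sum>j<Suc n. if j = 0 \<or> q j < r (j - 1) then (int x + int j - int (q j)) * ?w else 0)"
  proof (rule sum.mono_neutral_cong_left)
    show "\<forall>j\<in>{..<Suc n} - {j. j < Suc n \<and> shape (Suc n) (add_box q j)}.
        (if j = 0 \<or> q j < r (j - 1) then (int x + int j - int (q j)) * ?w else 0) = 0"
    proof
      fix j assume j: "j \<in> {..<Suc n} - {j. j < Suc n \<and> shape (Suc n) (add_box q j)}"
      then have "0 < j" "q (j - 1) \<le> q j" "j - 1 < n"
        using shape_add_box_iff[OF q, of j] by auto
      then show "(if j = 0 \<or> q j < r (j - 1) then (int x + int j - int (q j)) * ?w else 0) = 0"
        using r1(2)[of "j - 1"] j by auto
    qed
  next
    fix j assume "j \<in> {j. j < Suc n \<and> shape (Suc n) (add_box q j)}"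
    then show "branching_weight n x (add_box q j) r =
        (if j = 0 \<or> q j < r (j - 1) then (int x + int j - int (q j)) * ?w else 0)"
      using outer[of j] by simp
  qed auto
  also have "\<dots> = (int x - int (q 0)) * ?w +
      (\<Sum>j<n. if q (Suc j) < r j then (int x + int (Suc j) - int (q (Suc j))) * ?w else 0)"
    by (subst sum.lessThan_Suc_shift) simp
  also have "(\<Sum>j<n. if q (Suc j) < r j then (int x + int (Suc j) - int (q (Suc j))) * ?w else 0) =
      (\<Sum>j<n. if q (Suc j) < r j then (int x + int j - int (r j) + 1) * ?w else 0) +
      (\<Sum>j<n. (int (r j) - int (q (Suc j))) * ?w)"
    unfolding sum.distrib[symmetric]
  proof (rule sum.cong[OF refl])
    fix j assume "j \<in> {..<n}"
    then have "q (Suc j) < r j \<or> q (Suc j) = r j" using r1(1)[of j] by auto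
    then show "(if q (Suc j) < r j then (int x + int (Suc j) - int (q (Suc j))) * ?w else 0) =
      (if q (Suc j) < r j then (int x + int j - int (r j) + 1) * ?w else 0) +
      (int (r j) - int (q (Suc j))) * ?w"
      by (auto simp: algebra_simps)
  qed
  also have "(\<Sum>j<n. if q (Suc j) < r j then (int x + int j - int (r j) + 1) * ?w else 0) =
      (\<Sum>j | j < n \<and> 0 < r j. branching_weight n x q (r(j := r j - 1)))"
    by (rule sum.mono_neutral_cong_right) (use inner in auto)
  finally show ?thesis
    using r by (simp add: branching_weight_def sum.lessThan_Suc_shift sum_subtractf
        sum_distrib_right[symmetric] algebra_simps del: sum.lessThan_Suc)
qed

text \<open>
  When \<open>q/r\<close> is not a horizontal strip, adding a cell to row \<open>j\<close> of \<open>q\<close> can only repair this if \<open>r\<close>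
  violates the interlacing in row \<open>j\<close> alone, by exactly one cell. Removing that cell from \<open>r\<close> is then the
  only other repair, and both have the same weight because row \<open>j\<close> of the strip is empty in either case.
\<close>

lemma branching_weight_exchange_not_interlacing:
  assumes q: "shape (Suc n) q" and r: "shape n r" "r \<notin> interlacing n q"
  shows "(\<Sum>j | j < Suc n \<and> shape (Suc n) (add_box q j). branching_weight n x (add_box q j) r) =
    (\<Sum>j | j < n \<and> 0 < r j. branching_weight n x q (r(j := r j - 1)))"
proof -
  let ?J = "{j. j < n \<and> r j = Suc (q j) \<and> r(j := r j - 1) \<in> interlacing n q}"
  have outer: "shape (Suc n) (add_box q j) \<and> r \<in> interlacing n (add_box q j) \<longleftrightarrow> j \<in> ?J"
    if "j < Suc n" for j
  proof
    assume a: "shape (Suc n) (add_box q j) \<and> r \<in> interlacing n (add_box q j)"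
    have *: "(q (Suc i) \<le> r i \<and> r i \<le> q i) \<or> (i = j \<and> r i = Suc (q i))" if "i < n" for i
    proof -
      have "add_box q j (Suc i) \<le> r i" "r i \<le> add_box q j i"
        using a that by (auto simp: interlacing_def)
      then show ?thesis by (auto simp: add_box_def split: if_splits)
    qed
    have "\<exists>i<n. \<not> (q (Suc i) \<le> r i \<and> r i \<le> q i)"
      using r shape_zero[OF r(1)] unfolding interlacing_def by blast
    then have "j < n" "r j = Suc (q j)" using * by blast+
    moreover have "r(j := r j - 1) \<in> interlacing n q"
      unfolding interlacing_def
      using * \<open>r j = Suc (q j)\<close> shape_Suc_le[OF q] shape_zero[OF r(1)] by auto
    ultimately show "j \<in> ?J" by blast
  next
    assume a: "j \<in> ?J"
    have *: "q (Suc i) \<le> (r(j := r j - 1)) i" "(r(j := r j - 1)) i \<le> q i" if "i < n" for i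
      using a that by (auto simp: interlacing_def)
    have prev: "q (Suc i) < r i" "r i \<le> q i" if "j = Suc i" for i
      using shape_Suc_le[OF r(1), of i] *[of i] a that by auto
    have "shape (Suc n) (add_box q j)"
    proof -
      have "j < Suc n" using a by simp
      moreover have "j = 0 \<or> q j < q (j - 1)"
      proof (cases j)
        case (Suc i)
        then show ?thesis using prev[of i] by simp
      qed simp
      ultimately show ?thesis using shape_add_box_iff[OF q] by blast
    qed
    moreover have "r \<in> interlacing n (add_box q j)"
      unfolding interlacing_def
    proof (safe, goal_cases)
      case (1 i)
      then show ?case using *[of i] prev[of i] a by (auto simp: add_box_def split: if_splits)
    next
      case (2 i)
      then show ?case using *[of i] prev[of i] a by (auto simp: add_box_def split: if_splits)
    next
      case (3 i)
      then show ?case using shape_zero[OF r(1)] by auto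
    qed
    ultimately show "shape (Suc n) (add_box q j) \<and> r \<in> interlacing n (add_box q j)" by blast
  qed
  have inner: "r j = Suc (q j)" if "j < n" "0 < r j" "r(j := r j - 1) \<in> interlacing n q" for j
  proof -
    have *: "q (Suc i) \<le> (r(j := r j - 1)) i" "(r(j := r j - 1)) i \<le> q i" if "i < n" for i
      using \<open>r(j := r j - 1) \<in> interlacing n q\<close> that by (auto simp: interlacing_def)
    obtain i where i: "i < n" "\<not> (q (Suc i) \<le> r i \<and> r i \<le> q i)"
      using r shape_zero[OF r(1)] unfolding interlacing_def by blast
    then have "i = j" using *[of i] by (auto split: if_splits)
    then show ?thesis using *[of i] i by auto
  qed
  have "(\<Sum>j | j < Suc n \<and> shape (Suc n) (add_box q j). branching_weight n x (add_box q j) r) =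
      (\<Sum>j\<in>?J. strip_weight n x q (r(j := r j - 1)))"
  proof (rule sum.mono_neutral_cong_right)
    show "?J \<subseteq> {j. j < Suc n \<and> shape (Suc n) (add_box q j)}"
    proof
      fix j assume "j \<in> ?J"
      moreover from this have "j < Suc n" by simp
      ultimately show "j \<in> {j. j < Suc n \<and> shape (Suc n) (add_box q j)}"
        using outer[of j] by blast
    qed
  next
    show "\<forall>j\<in>{j. j < Suc n \<and> shape (Suc n) (add_box q j)} - ?J.
        branching_weight n x (add_box q j) r = 0"
    proof
      fix j assume "j \<in> {j. j < Suc n \<and> shape (Suc n) (add_box q j)} - ?J"
      then show "branching_weight n x (add_box q j) r = 0"
        using outer[of j] unfolding branching_weight_def by (simp only: mem_Collect_eq Diff_iff) metis
    qed
  next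
    fix j assume j: "j \<in> ?J"
    then have "j < Suc n" by simp
    then have "r \<in> interlacing n (add_box q j)" using outer[of j] j by blast
    with j show "branching_weight n x (add_box q j) r = strip_weight n x q (r(j := r j - 1))"
      using strip_weight_empty_row[of j n r q x] by (simp add: branching_weight_def)
  qed simp
  also have "\<dots> = (\<Sum>j | j < n \<and> 0 < r j. branching_weight n x q (r(j := r j - 1)))"
  proof (rule sum.mono_neutral_cong_left)
    show "\<forall>j\<in>{j. j < n \<and> 0 < r j} - ?J. branching_weight n x q (r(j := r j - 1)) = 0"
      using inner by (auto simp only: branching_weight_def if_False mem_Collect_eq Diff_iff split: if_split)
  qed (auto simp: branching_weight_def)
  finally show ?thesis .
qed

text \<open>
  Adding a cell and removing a strip commute up to a scalar; here the coefficients at one resulting shape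
  \<open>r\<close> are compared.
\<close>

lemma branching_weight_exchange:
  assumes "shape (Suc n) q" "shape n r"
  shows "(\<Sum>j | j < Suc n \<and> shape (Suc n) (add_box q j). branching_weight n x (add_box q j) r) =
    (\<Sum>j | j < n \<and> 0 < r j. branching_weight n x q (r(j := r j - 1))) +
    (int x - (\<Sum>i<Suc n. int (q i)) + (\<Sum>i<n. int (r i))) * branching_weight n x q r"
  using branching_weight_exchange_interlacing[OF assms(1)]
    branching_weight_exchange_not_interlacing[OF assms]
  by (cases "r \<in> interlacing n q") (auto simp: branching_weight_def)

lemma shifted_schur_Suc_superset:
  assumes "finite R" "interlacing n q \<subseteq> R"
  shows "shifted_schur (Suc n) p q =
    (\<Sum>r\<in>R. branching_weight n (p 0) q r * shifted_schur n (\<lambda>i. p (Suc i)) r)"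
  unfolding shifted_schur.simps
  by (rule sum.mono_neutral_cong_left) (use assms in \<open>auto simp: branching_weight_def\<close>)

text \<open>
  Expanding by one branching step and exchanging, the terms in which a cell is removed from the
  intermediate shape \<open>r\<close> are reindexed by the smaller shape, where they form the Pieri sum for one variable
  less. The scalars \<open>|r|\<close> of the exchange cancel those of the induction hypothesis.
\<close>

theorem shifted_schur_pieri:
  assumes "shape n q"
  shows "(\<Sum>j | j < n \<and> shape n (add_box q j). shifted_schur n p (add_box q j)) =
    ((\<Sum>i<n. int (p i)) - (\<Sum>i<n. int (q i))) * shifted_schur n p q"
  using assms
proof (induction n arbitrary: p q)
  case 0
  then show ?case by simp
next
  case (Suc n)
  let ?S = "shifted_schur n (\<lambda>i. p (Suc i))"
  let ?w = "branching_weight n (p 0)"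
  let ?I = "interlacing n q"
  let ?c = "int (p 0) - (\<Sum>i<Suc n. int (q i))"
  \<comment> \<open>Large enough to contain all intermediate shapes for \<open>q\<close> and for \<open>q\<close> plus one cell.\<close>
  define R where "R = {r. shape n r \<and> r 0 \<le> Suc (q 0)}"
  have fin: "finite R" unfolding R_def by (rule finite_bounded_shapes)
  have sub: "interlacing n (add_box q j) \<subseteq> R" for j
    using interlacing_first_le[of _ n "add_box q j"]
    by (fastforce simp: R_def interlacing_shape add_box_def split: if_splits)
  have subq: "?I \<subseteq> R"
    by (auto simp: R_def interlacing_shape dest: interlacing_first_le)
  have "(\<Sum>j | j < Suc n \<and> shape (Suc n) (add_box q j). shifted_schur (Suc n) p (add_box q j)) =
      (\<Sum>r\<in>R. (\<Sum>j | j < Suc n \<and> shape (Suc n) (add_box q j). ?w (add_box q j) r) * ?S r)"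
    unfolding shifted_schur_Suc_superset[OF fin sub] sum_distrib_right by (rule sum.swap)
  also have "\<dots> = (\<Sum>r\<in>R. (\<Sum>j | j < n \<and> 0 < r j. ?w q (r(j := r j - 1)) * ?S r)
      + (?c + (\<Sum>i<n. int (r i))) * ?w q r * ?S r)"
    by (rule sum.cong[OF refl], subst branching_weight_exchange[OF Suc.prems])
      (auto simp: R_def distrib_right sum_distrib_right)
  also have "\<dots> = (\<Sum>r\<in>R. \<Sum>j | j < n \<and> 0 < r j. ?w q (r(j := r j - 1)) * ?S r)
      + (\<Sum>r\<in>R. (?c + (\<Sum>i<n. int (r i))) * ?w q r * ?S r)"
    by (rule sum.distrib)
  also have "(\<Sum>r\<in>R. \<Sum>j | j < n \<and> 0 < r j. ?w q (r(j := r j - 1)) * ?S r) =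
      (\<Sum>(r, j)\<in>(SIGMA r:R. {j. j < n \<and> 0 < r j}). ?w q (r(j := r j - 1)) * ?S r)"
    by (rule sum.Sigma) (auto simp: fin)
  also have "\<dots> = (\<Sum>(r, j)\<in>(SIGMA r:?I. {j. j < n \<and> shape n (add_box r j)}). 
      ?w q r * ?S (add_box r j))"
  proof -
    let ?A = "SIGMA r:R. {j. j < n \<and> 0 < r j \<and> r(j := r j - 1) \<in> ?I}"
    have "(\<Sum>(r, j)\<in>(SIGMA r:R. {j. j < n \<and> 0 < r j}). ?w q (r(j := r j - 1)) * ?S r) =
        (\<Sum>(r, j)\<in>?A. ?w q (r(j := r j - 1)) * ?S r)"
    proof (rule sum.mono_neutral_right)
      show "\<forall>z\<in>(SIGMA r:R. {j. j < n \<and> 0 < r j}) - ?A.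
          (case z of (r, j) \<Rightarrow> ?w q (r(j := r j - 1)) * ?S r) = 0"
      proof
        fix z assume "z \<in> (SIGMA r:R. {j. j < n \<and> 0 < r j}) - ?A"
        then obtain r j where "z = (r, j)" "r(j := r j - 1) \<notin> ?I" by blast
        then show "(case z of (r, j) \<Rightarrow> ?w q (r(j := r j - 1)) * ?S r) = 0"
          by (simp add: branching_weight_def)
      qed
    qed (auto simp: fin)
    also have "\<dots> = (\<Sum>(r, j)\<in>(SIGMA r:?I. {j. j < n \<and> shape n (add_box r j)}). 
      ?w q r * ?S (add_box r j))"
    proof (rule sum.reindex_bij_witness[where
          i = "\<lambda>(r, j). (add_box r j, j)" and j = "\<lambda>(r, j). (r(j := r j - 1), j)"])
      fix z assume "z \<in> ?A"
      then obtain r j where z: "z = (r, j)" "r \<in> R" "j < n" "0 < r j" "r(j := r j - 1) \<in> ?I"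
        by blast
      then have *: "add_box (r(j := r j - 1)) j = r" by (simp add: add_box_def)
      show "(case case z of (r, j) \<Rightarrow> (r(j := r j - 1), j) of (r, j) \<Rightarrow> (add_box r j, j)) = z"
        using z(1) * by simp
      show "(case z of (r, j) \<Rightarrow> (r(j := r j - 1), j)) \<in>
          (SIGMA r:?I. {j. j < n \<and> shape n (add_box r j)})"
        using z * by (simp add: R_def)
      show "(case case z of (r, j) \<Rightarrow> (r(j := r j - 1), j) of (r, j) \<Rightarrow> ?w q r * ?S (add_box r j)) =
          (case z of (r, j) \<Rightarrow> ?w q (r(j := r j - 1)) * ?S r)"
        using z(1) * by simp
    next
      fix z assume "z \<in> (SIGMA r:?I. {j. j < n \<and> shape n (add_box r j)})"
      then obtain r j where z: "z = (r, j)" "r \<in> ?I" "j < n" "shape n (add_box r j)"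
        by blast
      have *: "(add_box r j)(j := add_box r j j - 1) = r" by (simp add: add_box_def)
      have "add_box r j \<in> R"
        using z interlacing_first_le[OF z(2)] by (auto simp: R_def add_box_def)
      then show "(case z of (r, j) \<Rightarrow> (add_box r j, j)) \<in> ?A"
        using z * by (simp add: add_box_def)
      show "(case case z of (r, j) \<Rightarrow> (add_box r j, j) of (r, j) \<Rightarrow> (r(j := r j - 1), j)) = z"
        using z(1) * by simp
    qed
    finally show ?thesis .
  qed
  also have "\<dots> = (\<Sum>r\<in>?I. \<Sum>j | j < n \<and> shape n (add_box r j). ?w q r * ?S (add_box r j))"
    by (rule sum.Sigma[symmetric]) (auto simp: finite_interlacing)
  also have "\<dots> = (\<Sum>r\<in>?I. ((\<Sum>i<n. int (p (Suc i))) - (\<Sum>i<n. int (r i))) * ?w q r * ?S r)"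
  proof (rule sum.cong[OF refl])
    fix r assume "r \<in> ?I"
    then show "(\<Sum>j | j < n \<and> shape n (add_box r j). ?w q r * ?S (add_box r j)) =
      ((\<Sum>i<n. int (p (Suc i))) - (\<Sum>i<n. int (r i))) * ?w q r * ?S r"
      using Suc.IH[OF interlacing_shape, of r q "\<lambda>i. p (Suc i)"]
      by (simp add: sum_distrib_left[symmetric] mult_ac)
  qed
  also have "\<dots> = (\<Sum>r\<in>R. ((\<Sum>i<n. int (p (Suc i))) - (\<Sum>i<n. int (r i))) * ?w q r * ?S r)"
    by (rule sum.mono_neutral_left) (use fin subq in \<open>auto simp: branching_weight_def\<close>)
  also have "\<dots> + (\<Sum>r\<in>R. (?c + (\<Sum>i<n. int (r i))) * ?w q r * ?S r) =
      ((\<Sum>i<Suc n. int (p i)) - (\<Sum>i<Suc n. int (q i))) * (\<Sum>r\<in>R. ?w q r * ?S r)"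
    unfolding sum.distrib[symmetric] sum_distrib_left sum.lessThan_Suc_shift[of "\<lambda>i. int (p i)"]
    by (rule sum.cong[OF refl]) (simp add: algebra_simps)
  also have "(\<Sum>r\<in>R. ?w q r * ?S r) = shifted_schur (Suc n) p q"
    by (rule shifted_schur_Suc_superset[OF fin subq, symmetric])
  finally show ?case .
qed

text \<open>
  If row \<open>j + 1\<close> of \<open>q\<close> is longer than that of \<open>p\<close>, then so is row \<open>j\<close> of every interlacing \<open>r\<close> compared
  with the shifted \<open>p\<close>, and induction applies. If row 0 of \<open>q\<close> is too long, either the strip contains the
  cell \<open>(0, p 0)\<close>, whose weight is 0, or already row 0 of \<open>r\<close> is longer than \<open>p 0\<close>, which is at least \<open>p 1\<close>.
\<close>

lemma shifted_schur_vanishing: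
  assumes "shape n p" "j < n" "p j < q j"
  shows "shifted_schur n p q = 0"
  using assms
proof (induction n arbitrary: p q j)
  case 0
  then show ?case by simp
next
  case (Suc n)
  have "strip_weight n (p 0) q r * shifted_schur n (\<lambda>i. p (Suc i)) r = 0"
    if r: "r \<in> interlacing n q" for r
  proof (cases j)
    case 0
    show ?thesis
    proof (cases "r 0 \<le> p 0")
      case True
      then have "p 0 \<in> {r 0..<q 0}" using Suc.prems 0 by auto
      then have "(\<Prod>c\<in>{r 0..<q 0}. int (p 0) + int 0 - int c) = 0"
        by (intro prod_zero bexI[of _ "p 0"]) auto
      then have "strip_weight n (p 0) q r = 0"
        unfolding strip_weight_def by (subst prod.remove[of _ 0]) auto
      then show ?thesis by simp
    next
      case False
      moreover have "0 < n" using False r by (cases n) (auto simp: interlacing_def)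
      moreover have "p (Suc 0) \<le> p 0" using Suc.prems(1) by (rule shape_Suc_le)
      ultimately show ?thesis
        using Suc.IH[OF shape_tail[OF Suc.prems(1)], of 0 r] by simp
    qed
  next
    case (Suc k)
    then have "k < n" "p (Suc k) < r k" using Suc.prems r by (fastforce simp: interlacing_def)+
    then show ?thesis
      using Suc.IH[OF shape_tail[OF Suc.prems(1)], of k r] by simp
  qed
  then show ?case unfolding shifted_schur.simps by (intro sum.neutral) blast
qed

section \<open>Flagged tableaux\<close>

definition skew_cells :: "(nat \<Rightarrow> nat) \<Rightarrow> (nat \<Rightarrow> nat) \<Rightarrow> (nat \<times> nat) set" where
  "skew_cells p q = {(i, j). q i \<le> j \<and> j < p i}"

definition flagged_tableaux :: "(nat \<Rightarrow> nat) \<Rightarrow> (nat \<Rightarrow> nat) \<Rightarrow> (nat \<times> nat \<Rightarrow> nat) set" where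
  "flagged_tableaux p q =
     {U \<in> skew_cells p q \<rightarrow>\<^sub>E UNIV.
        rows_weakly_increasing (skew_cells p q) U \<and>
        cols_strictly_increasing (skew_cells p q) U \<and>
        (\<forall>(i, j) \<in> skew_cells p q. U (i, j) \<le> i)}"

definition missing_entries ::
    "(nat \<Rightarrow> nat) \<Rightarrow> (nat \<Rightarrow> nat) \<Rightarrow> (nat \<times> nat \<Rightarrow> nat) \<Rightarrow> (nat \<times> nat) set" where
  "missing_entries p q U = {(j, t). j < p t \<and> \<not> (\<exists>i. (i, j) \<in> skew_cells p q \<and> U (i, j) = t)}"

text \<open>
  The rows in which column \<open>j\<close> holds either a cell of the inner shape or an entry below \<open>t\<close>. For a tableau
  they form an initial segment, so their number is the row, counted from 1, after which \<open>t\<close> would be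
  inserted.
\<close>

definition rows_before ::
    "(nat \<Rightarrow> nat) \<Rightarrow> (nat \<Rightarrow> nat) \<Rightarrow> (nat \<times> nat \<Rightarrow> nat) \<Rightarrow> nat \<Rightarrow> nat \<Rightarrow> nat set" where
  "rows_before p q U j t = {i. j < q i \<or> (i, j) \<in> skew_cells p q \<and> U (i, j) < t}"

definition tableau_weight ::
    "(nat \<Rightarrow> nat) \<Rightarrow> (nat \<Rightarrow> nat) \<Rightarrow> (nat \<times> nat \<Rightarrow> nat) \<Rightarrow> int" where
  "tableau_weight p q U = (\<Prod>(j, t)\<in>missing_entries p q U.
     int (p t) - int t + int (card (rows_before p q U j t)) - int j - 1)"

text \<open>
  Peeling removes row 0 of the outer shape and moves the other rows up by one. Cells with entry 0 join
  the cells of the inner shape, and all other entries drop by one.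
\<close>

definition peel_shape ::
    "(nat \<Rightarrow> nat) \<Rightarrow> (nat \<Rightarrow> nat) \<Rightarrow> (nat \<times> nat \<Rightarrow> nat) \<Rightarrow> nat \<Rightarrow> nat" where
  "peel_shape p q U i = card {j. j < p (Suc i) \<and> (j < q (Suc i) \<or> U (Suc i, j) = 0)}"

definition peel ::
    "(nat \<Rightarrow> nat) \<Rightarrow> (nat \<Rightarrow> nat) \<Rightarrow> (nat \<times> nat \<Rightarrow> nat) \<Rightarrow> nat \<times> nat \<Rightarrow> nat" where
  "peel p q U =
     (\<lambda>(i, j)\<in>skew_cells (\<lambda>i. p (Suc i)) (peel_shape p q U). U (Suc i, j) - 1)"

definition unpeel ::
    "(nat \<Rightarrow> nat) \<Rightarrow> (nat \<Rightarrow> nat) \<Rightarrow> (nat \<Rightarrow> nat) \<Rightarrow> (nat \<times> nat \<Rightarrow> nat) \<Rightarrow> nat \<times> nat \<Rightarrow> nat" where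
  "unpeel p q r U =
     (\<lambda>(i, j)\<in>skew_cells p q. if i = 0 \<or> j < r (i - 1) then 0 else Suc (U (i - 1, j)))"

lemma less_card_down_closed_iff:
  fixes A :: "nat set"
  assumes "finite A" "\<And>a b. b \<in> A \<Longrightarrow> a < b \<Longrightarrow> a \<in> A"
  shows "j < card A \<longleftrightarrow> j \<in> A"
proof -
  have "A = {..<card A}"
  proof (cases "A = {}")
    case False
    with assms(1) have "A = {..Max A}"
      using assms(2)[OF Max_in[OF assms(1) False]] Max_ge[OF assms(1)]
      by (auto simp: le_less dest: Max_in)
    then have "card A = Suc (Max A)" by (metis card_atMost)
    then show ?thesis using \<open>A = {..Max A}\<close> by (simp add: lessThan_Suc_atMost)
  qed simp
  then show ?thesis by blast
qed

lemma finite_skew_cells: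
  assumes "shape n p"
  shows "finite (skew_cells p q)"
proof (rule finite_subset)
  show "skew_cells p q \<subseteq> {..<n} \<times> {..<p 0}"
  proof
    fix u assume "u \<in> skew_cells p q"
    then obtain i j where u: "u = (i, j)" "j < p i" by (auto simp: skew_cells_def)
    then have "i < n" using shape_zero[OF assms, of i] by (cases "i < n") auto
    moreover have "j < p 0" using u shape_le[OF assms, of 0 i] by simp
    ultimately show "u \<in> {..<n} \<times> {..<p 0}" using u by simp
  qed
qed simp

lemma finite_flagged_tableaux:
  assumes "shape n p"
  shows "finite (flagged_tableaux p q)"
proof (rule finite_subset)
  show "flagged_tableaux p q \<subseteq> skew_cells p q \<rightarrow>\<^sub>E {..n}"
  proof
    fix U assume U: "U \<in> flagged_tableaux p q"
    have "U u \<in> {..n}" if u: "u \<in> skew_cells p q" for u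
    proof -
      obtain i j where ij: "u = (i, j)" by (cases u)
      then have "U u \<le> i" using U u by (auto simp: flagged_tableaux_def)
      moreover have "i < n"
        using u ij shape_zero[OF assms, of i] by (cases "i < n") (auto simp: skew_cells_def)
      ultimately show ?thesis by simp
    qed
    then show "U \<in> skew_cells p q \<rightarrow>\<^sub>E {..n}" using U by (auto simp: flagged_tableaux_def PiE_def)
  qed
  show "finite (skew_cells p q \<rightarrow>\<^sub>E {..n})"
    by (intro finite_PiE finite_skew_cells[OF assms]) auto
qed

lemma flagged_tableauxD:
  assumes "U \<in> flagged_tableaux p q"
  shows "(i, j) \<in> skew_cells p q \<Longrightarrow> (i, j') \<in> skew_cells p q \<Longrightarrow> j < j' \<Longrightarrow> U (i, j) \<le> U (i, j')"
    and "(i, j) \<in> skew_cells p q \<Longrightarrow> (i', j) \<in> skew_cells p q \<Longrightarrow> i < i' \<Longrightarrow> U (i, j) < U (i', j)"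
    and "(i, j) \<in> skew_cells p q \<Longrightarrow> U (i, j) \<le> i"
    and "(i, j) \<notin> skew_cells p q \<Longrightarrow> U (i, j) = undefined"
  using assms
  by (auto simp: flagged_tableaux_def rows_weakly_increasing_def cols_strictly_increasing_def PiE_def
      extensional_def)

text \<open>
  Rows increase weakly, so the cells of the inner shape and the entries 0 form an initial segment of
  each row and are determined by their number.
\<close>

lemma less_peel_shape_iff:
  assumes "U \<in> flagged_tableaux p q"
  shows "j < peel_shape p q U i \<longleftrightarrow> j < p (Suc i) \<and> (j < q (Suc i) \<or> U (Suc i, j) = 0)"
proof -
  let ?A = "{j. j < p (Suc i) \<and> (j < q (Suc i) \<or> U (Suc i, j) = 0)}"
  have "a \<in> ?A" if b: "b \<in> ?A" and "a < b" for a b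
  proof (cases "a < q (Suc i)")
    case True
    then show ?thesis using that by simp
  next
    case False
    then have "(Suc i, a) \<in> skew_cells p q" "(Suc i, b) \<in> skew_cells p q"
      using that by (auto simp: skew_cells_def)
    then have "U (Suc i, a) \<le> U (Suc i, b)" using flagged_tableauxD(1)[OF assms] that by blast
    then show ?thesis using that False by auto
  qed
  then have "j < card ?A \<longleftrightarrow> j \<in> ?A" by (intro less_card_down_closed_iff) auto
  then show ?thesis by (simp add: peel_shape_def)
qed

context
  fixes n :: nat and p q :: "nat \<Rightarrow> nat"
  assumes p: "shape (Suc n) p" and q: "shape (Suc n) q" and qp: "\<And>i. q i \<le> p i"
begin

lemma peel_shape_le: 
  assumes "U \<in> flagged_tableaux p q"
  shows "peel_shape p q U i \<le> p (Suc i)"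
  using less_peel_shape_iff[OF assms, of "p (Suc i)" i] by simp

text \<open>
  An entry 0 is the topmost entry of its column, since columns increase strictly. So if it lies below
  row 0, the cell above it belongs to \<open>q\<close>, and the upward move does not carry it beyond \<open>q\<close>.
\<close>

lemma peel_shape_interlacing:
  assumes U: "U \<in> flagged_tableaux p q"
  shows "peel_shape p q U \<in> interlacing n q"
  unfolding interlacing_def
proof (intro CollectI conjI allI impI)
  fix i assume "i < n"
  show "q (Suc i) \<le> peel_shape p q U i"
    using less_peel_shape_iff[OF U, of "peel_shape p q U i" i] qp[of "Suc i"] by force
  show "peel_shape p q U i \<le> q i"
  proof (rule ccontr)
    assume "\<not> ?thesis"
    then have *: "q i < p (Suc i)" "q i < q (Suc i) \<or> U (Suc i, q i) = 0"
      using less_peel_shape_iff[OF U, of "q i" i] by auto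
    then have "(Suc i, q i) \<in> skew_cells p q" "(i, q i) \<in> skew_cells p q"
      using shape_Suc_le[OF q, of i] shape_Suc_le[OF p, of i] by (auto simp: skew_cells_def)
    then have "U (i, q i) < U (Suc i, q i)" using flagged_tableauxD(2)[OF U] by blast
    then show False using * shape_Suc_le[OF q, of i] by simp
  qed
next
  fix i assume "n \<le> i"
  then show "peel_shape p q U i = 0"
    using peel_shape_le[OF U, of i] shape_zero[OF p, of "Suc i"] by simp
qed

lemma skew_cells_peel_iff:
  assumes U: "U \<in> flagged_tableaux p q"
  shows "(i, j) \<in> skew_cells (\<lambda>i. p (Suc i)) (peel_shape p q U) \<longleftrightarrow>
    (Suc i, j) \<in> skew_cells p q \<and> 0 < U (Suc i, j)"
  using less_peel_shape_iff[OF U, of j i] by (auto simp: skew_cells_def not_le not_less)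

lemma peel_eq:
  assumes U: "U \<in> flagged_tableaux p q" and "(Suc i, j) \<in> skew_cells p q" "0 < U (Suc i, j)"
  shows "peel p q U (i, j) = U (Suc i, j) - 1"
  using assms by (simp add: peel_def skew_cells_peel_iff)

lemma peel_flagged:
  assumes U: "U \<in> flagged_tableaux p q"
  shows "peel p q U \<in> flagged_tableaux (\<lambda>i. p (Suc i)) (peel_shape p q U)"
proof -
  note D = flagged_tableauxD[OF U]
  let ?K = "skew_cells (\<lambda>i. p (Suc i)) (peel_shape p q U)"
  have cell: "(Suc i, j) \<in> skew_cells p q" "0 < U (Suc i, j)" "peel p q U (i, j) = U (Suc i, j) - 1"
    if "(i, j) \<in> ?K" for i j
    using that skew_cells_peel_iff[OF U] peel_eq[OF U] by blast+
  have "peel p q U \<in> ?K \<rightarrow>\<^sub>E UNIV" by (simp add: peel_def)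
  moreover have "rows_weakly_increasing ?K (peel p q U)"
    unfolding rows_weakly_increasing_def
  proof (intro allI impI)
    fix i j j' assume a: "(i, j) \<in> ?K" "(i, j') \<in> ?K" "j < j'"
    show "peel p q U (i, j) \<le> peel p q U (i, j')"
      using D(1)[OF cell(1)[OF a(1)] cell(1)[OF a(2)] a(3)] cell[OF a(1)] cell[OF a(2)] by simp
  qed
  moreover have "cols_strictly_increasing ?K (peel p q U)"
    unfolding cols_strictly_increasing_def
  proof (intro allI impI)
    fix i i' j assume a: "(i, j) \<in> ?K" "(i', j) \<in> ?K" "i < i'"
    have "U (Suc i, j) < U (Suc i', j)"
      using D(2)[OF cell(1)[OF a(1)] cell(1)[OF a(2)]] a(3) by simp
    then show "peel p q U (i, j) < peel p q U (i', j)"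
      using cell[OF a(1)] cell[OF a(2)] by simp
  qed
  moreover have "peel p q U (i, j) \<le> i" if "(i, j) \<in> ?K" for i j
    using D(3)[OF cell(1)[OF that]] cell(3)[OF that] by simp
  ultimately show ?thesis by (auto simp: flagged_tableaux_def)
qed

text \<open>
  The inserted zeros lie directly below the cells of \<open>q\<close>: as \<open>r i \<le> q i\<close>, a zero in row \<open>i + 1\<close> has a
  cell of \<open>q\<close> above it. That keeps the columns strict.
\<close>

lemma unpeel_flagged:
  assumes r: "r \<in> interlacing n q" and U: "U \<in> flagged_tableaux (\<lambda>i. p (Suc i)) r"
  shows "unpeel p q r U \<in> flagged_tableaux p q"
proof -
  note D = flagged_tableauxD[OF U]
  let ?K = "skew_cells p q"
  have cell: "unpeel p q r U (0, j) = 0" if "(0, j) \<in> ?K" for j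
    using that by (simp add: unpeel_def)
  have zero: "unpeel p q r U (Suc i, j) = 0" if "(Suc i, j) \<in> ?K" "j < r i" for i j
    using that by (simp add: unpeel_def)
  have pos: "unpeel p q r U (Suc i, j) = Suc (U (i, j))" "(i, j) \<in> skew_cells (\<lambda>i. p (Suc i)) r"
    if "(Suc i, j) \<in> ?K" "\<not> j < r i" for i j
    using that by (auto simp: unpeel_def skew_cells_def)
  have rq: "r i \<le> q i" for i
    using r by (cases "i < n") (auto simp: interlacing_def)
  have "unpeel p q r U \<in> ?K \<rightarrow>\<^sub>E UNIV" by (simp add: unpeel_def)
  moreover have "rows_weakly_increasing ?K (unpeel p q r U)"
    unfolding rows_weakly_increasing_def
  proof (intro allI impI)
    fix i j j' assume a: "(i, j) \<in> ?K" "(i, j') \<in> ?K" "j < j'"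
    show "unpeel p q r U (i, j) \<le> unpeel p q r U (i, j')"
    proof (cases i)
      case 0
      then show ?thesis using cell a by simp
    next
      case (Suc k)
      show ?thesis
      proof (cases "j < r k")
        case True
        then show ?thesis using zero a Suc by simp
      next
        case False
        then show ?thesis using pos[of k j] pos[of k j'] D(1)[of k j j'] a Suc by auto
      qed
    qed
  qed
  moreover have "cols_strictly_increasing ?K (unpeel p q r U)"
    unfolding cols_strictly_increasing_def
  proof (intro allI impI)
    fix i i' j assume a: "(i, j) \<in> ?K" "(i', j) \<in> ?K" "i < i'"
    then obtain k' where k': "i' = Suc k'" by (cases i') auto
    have "\<not> j < r k'"
      using a k' rq[of k'] shape_le[OF q, of i k'] by (auto simp: skew_cells_def)
    note pos' = pos[OF _ this] 
    show "unpeel p q r U (i, j) < unpeel p q r U (i', j)"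
    proof (cases "i = 0 \<or> j < r (i - 1)")
      case True
      then show ?thesis using cell zero[of "i - 1" j] pos' a k' by (cases i) auto
    next
      case False
      then obtain k where k: "i = Suc k" "\<not> j < r k" by (cases i) auto
      then show ?thesis using pos[of k j] pos' a k' D(2)[of k j k'] by auto
    qed
  qed
  moreover have "unpeel p q r U (i, j) \<le> i" if "(i, j) \<in> ?K" for i j
  proof (cases "i = 0 \<or> j < r (i - 1)")
    case True
    then show ?thesis using cell zero[of "i - 1" j] that by (cases i) auto
  next
    case False
    then obtain k where k: "i = Suc k" "\<not> j < r k" by (cases i) auto
    then show ?thesis using pos[of k j] that D(3)[of k j] by auto
  qed
  ultimately show ?thesis by (auto simp: flagged_tableaux_def)
qed

lemma peel_shape_unpeel:
  assumes r: "r \<in> interlacing n q" "\<And>i. r i \<le> p (Suc i)"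
    and U: "U \<in> flagged_tableaux (\<lambda>i. p (Suc i)) r"
  shows "peel_shape p q (unpeel p q r U) = r"
proof
  fix i
  have qr: "q (Suc i) \<le> r i"
    using r shape_zero[OF q, of "Suc i"] by (cases "i < n") (auto simp: interlacing_def)
  have "j < peel_shape p q (unpeel p q r U) i \<longleftrightarrow> j < r i" for j
  proof (cases "(Suc i, j) \<in> skew_cells p q")
    case True
    then show ?thesis
      using less_peel_shape_iff[OF unpeel_flagged[OF r(1) U], of j i]
      by (auto simp: unpeel_def skew_cells_def)
  next
    case False
    then show ?thesis
      using less_peel_shape_iff[OF unpeel_flagged[OF r(1) U], of j i] qr r(2)[of i] qp[of "Suc i"]
      by (auto simp: skew_cells_def)
  qed
  then show "peel_shape p q (unpeel p q r U) i = r i"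
    by (metis less_irrefl linorder_neqE_nat)
qed

lemma peel_unpeel:
  assumes r: "r \<in> interlacing n q" "\<And>i. r i \<le> p (Suc i)"
    and U: "U \<in> flagged_tableaux (\<lambda>i. p (Suc i)) r"
  shows "peel p q (unpeel p q r U) = U"
proof
  fix u :: "nat \<times> nat"
  obtain i j where u: "u = (i, j)" by (cases u)
  have qr: "q (Suc i) \<le> r i"
    using r shape_zero[OF q, of "Suc i"] by (cases "i < n") (auto simp: interlacing_def)
  show "peel p q (unpeel p q r U) u = U u"
    unfolding peel_def peel_shape_unpeel[OF assms]
    using flagged_tableauxD(4)[OF U] u qr by (auto simp: unpeel_def skew_cells_def restrict_def)
qed

lemma unpeel_peel:
  assumes U: "U \<in> flagged_tableaux p q"
  shows "unpeel p q (peel_shape p q U) (peel p q U) = U"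
proof
  fix u :: "nat \<times> nat"
  obtain i j where u: "u = (i, j)" by (cases u)
  show "unpeel p q (peel_shape p q U) (peel p q U) u = U u"
  proof (cases "(i, j) \<in> skew_cells p q")
    case False
    then show ?thesis using flagged_tableauxD(4)[OF U] u by (auto simp: unpeel_def)
  next
    case True
    show ?thesis
    proof (cases i)
      case 0
      then show ?thesis using flagged_tableauxD(3)[OF U True] True u by (simp add: unpeel_def)
    next
      case (Suc k)
      then have "j < peel_shape p q U k \<longleftrightarrow> U (Suc k, j) = 0"
        using True less_peel_shape_iff[OF U, of j k] by (auto simp: skew_cells_def)
      then show ?thesis
        using True Suc u peel_eq[OF U, of k j] by (auto simp: unpeel_def)
    qed
  qed
qed

text \<open>
  A column lacks the entry 0 exactly if its lowest cell in \<open>q\<close> is peeled off: otherwise, after the upward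
  move, the entry 0 below that cell takes its place. A column without cells of \<open>q\<close> has its 0 in row 0.
  This matches the missing zeros with the cells of the
  strip \<open>q/r\<close>.
\<close>

lemma missing_entries_0_iff:
  assumes U: "U \<in> flagged_tableaux p q"
  shows "(j, 0) \<in> missing_entries p q U \<longleftrightarrow> (\<exists>i\<le>n. peel_shape p q U i \<le> j \<and> j < q i)"
proof
  assume a: "(j, 0) \<in> missing_entries p q U"
  have "0 < U (0, j)" if "q 0 \<le> j"
    using a that by (auto simp: missing_entries_def skew_cells_def)
  moreover have "U (0, j) = 0" if "q 0 \<le> j"
    using a that flagged_tableauxD(3)[OF U, of 0 j] by (auto simp: missing_entries_def skew_cells_def)
  ultimately have "j < q 0" by force
  \<comment> \<open>The last row of \<open>q\<close> that reaches column \<open>j\<close>.\<close>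
  have "\<exists>i. j < q i \<and> \<not> j < q (Suc i)"
  proof (rule ccontr)
    assume "\<nexists>i. j < q i \<and> \<not> j < q (Suc i)"
    then have "j < q k" for k using \<open>j < q 0\<close> by (induction k) auto
    from this[of "Suc n"] show False using shape_zero[OF q] by simp
  qed
  then obtain i where i: "j < q i" "\<not> j < q (Suc i)" by blast
  then have "i \<le> n" using shape_zero[OF q, of i] by (cases "i \<le> n") auto
  have "\<not> j < peel_shape p q U i"
    using i a less_peel_shape_iff[OF U, of j i] by (auto simp: missing_entries_def skew_cells_def)
  then show "\<exists>i\<le>n. peel_shape p q U i \<le> j \<and> j < q i" using i \<open>i \<le> n\<close> by auto
next
  assume "\<exists>i\<le>n. peel_shape p q U i \<le> j \<and> j < q i"
  then obtain i where i: "peel_shape p q U i \<le> j" "j < q i" by blast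
  have "j < p 0" using i(2) qp[of i] shape_le[OF p, of 0 i] by simp
  moreover have "U (k, j) \<noteq> 0" if k: "(k, j) \<in> skew_cells p q" for k
  proof
    assume z: "U (k, j) = 0"
    have "i < k" using i k shape_le[OF q, of k i] by (cases "k \<le> i") (auto simp: skew_cells_def)
    then obtain m where m: "k = Suc m" "i \<le> m" by (cases k) auto
    then have "j < peel_shape p q U m"
      using z k less_peel_shape_iff[OF U, of j m] by (auto simp: skew_cells_def)
    also have "\<dots> \<le> peel_shape p q U i"
      by (rule shape_le[OF interlacing_shape[OF peel_shape_interlacing[OF U]] m(2)])
    finally show False using i by simp
  qed
  ultimately show "(j, 0) \<in> missing_entries p q U" by (auto simp: missing_entries_def)
qed

lemma rows_before_0:
  assumes U: "U \<in> flagged_tableaux p q" and i: "i \<le> n" "peel_shape p q U i \<le> j" "j < q i"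
  shows "rows_before p q U j 0 = {..i}"
proof -
  have "q (Suc i) \<le> peel_shape p q U i"
    using peel_shape_interlacing[OF U] i(1) shape_zero[OF q, of "Suc i"]
    by (cases "i < n") (auto simp: interlacing_def)
  then have "j < q k \<longleftrightarrow> k \<le> i" for k
    using i shape_le[OF q, of k i] shape_le[OF q, of "Suc i" k] by (cases "k \<le> i") auto
  then show ?thesis by (auto simp: rows_before_def)
qed

text \<open>
  The cell \<open>(i, j)\<close> of the strip is the lowest one of \<open>q\<close> in column \<open>j\<close>, so \<open>i + 1\<close> cells precede the
  missing 0 and its factor is \<open>p 0 + i - j\<close>, the weight of that cell.
\<close>

lemma prod_missing_0:
  assumes U: "U \<in> flagged_tableaux p q"
  shows "(\<Prod>j | (j, 0) \<in> missing_entries p q U.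
      int (p 0) - int 0 + int (card (rows_before p q U j 0)) - int j - 1) =
    strip_weight n (p 0) q (peel_shape p q U)"
proof -
  let ?r = "peel_shape p q U"
  let ?f = "\<lambda>j. int (p 0) - int 0 + int (card (rows_before p q U j 0)) - int j - 1"
  have eq: "{j. (j, 0) \<in> missing_entries p q U} = (\<Union>i\<in>{..n}. {?r i..<q i})"
    using missing_entries_0_iff[OF U] by auto
  have "prod ?f {j. (j, 0) \<in> missing_entries p q U} = (\<Prod>i\<le>n. prod ?f {?r i..<q i})"
    unfolding eq
  proof (rule prod.UNION_disjoint)
    show "\<forall>i\<in>{..n}. \<forall>k\<in>{..n}. i \<noteq> k \<longrightarrow> {?r i..<q i} \<inter> {?r k..<q k} = {}"
    proof (intro ballI impI)
      fix i k assume ik: "i \<in> {..n}" "k \<in> {..n}" "i \<noteq> k"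
      have "i = k" if "j \<in> {?r i..<q i}" "j \<in> {?r k..<q k}" for j
        using rows_before_0[OF U, of i j] rows_before_0[OF U, of k j] ik that by auto
      then show "{?r i..<q i} \<inter> {?r k..<q k} = {}" using ik by blast
    qed
  qed auto
  also have "\<dots> = strip_weight n (p 0) q ?r"
    unfolding strip_weight_def
    by (intro prod.cong refl) (simp add: rows_before_0[OF U])
  finally show ?thesis .
qed

lemma missing_entries_Suc_iff:
  assumes U: "U \<in> flagged_tableaux p q"
  shows "(j, Suc t) \<in> missing_entries p q U \<longleftrightarrow>
    (j, t) \<in> missing_entries (\<lambda>i. p (Suc i)) (peel_shape p q U) (peel p q U)"
proof -
  have "(\<exists>i. (i, j) \<in> skew_cells p q \<and> U (i, j) = Suc t) \<longleftrightarrow>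
    (\<exists>i. (Suc i, j) \<in> skew_cells p q \<and> U (Suc i, j) = Suc t)"
  proof
    assume "\<exists>i. (i, j) \<in> skew_cells p q \<and> U (i, j) = Suc t"
    then obtain i where i: "(i, j) \<in> skew_cells p q" "U (i, j) = Suc t" by blast
    then obtain k where "i = Suc k" using flagged_tableauxD(3)[OF U i(1)] by (cases i) auto
    then show "\<exists>i. (Suc i, j) \<in> skew_cells p q \<and> U (Suc i, j) = Suc t" using i by blast
  qed blast
  also have "\<dots> \<longleftrightarrow> (\<exists>i. (i, j) \<in> skew_cells (\<lambda>i. p (Suc i)) (peel_shape p q U) \<and>
      peel p q U (i, j) = t)"
    using skew_cells_peel_iff[OF U, of _ j] peel_eq[OF U, of _ j]
    by (metis Suc_diff_1 diff_Suc_1 zero_less_Suc)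
  finally have "(\<exists>i. (i, j) \<in> skew_cells p q \<and> U (i, j) = Suc t) \<longleftrightarrow>
    (\<exists>i. (i, j) \<in> skew_cells (\<lambda>i. p (Suc i)) (peel_shape p q U) \<and> peel p q U (i, j) = t)" .
  then show ?thesis by (simp only: missing_entries_def mem_Collect_eq prod.case)
qed

text \<open>
  Row 0 always counts, because there a cell of column \<open>j\<close> lies in \<open>q\<close> or has entry 0; the other rows
  move up by one. Together with the shift of \<open>t\<close> this leaves the factor of a missing entry unchanged.
\<close>

lemma rows_before_Suc:
  assumes U: "U \<in> flagged_tableaux p q" and j: "j < p 0"
  shows "rows_before p q U j (Suc t) =
    insert 0 (Suc ` rows_before (\<lambda>i. p (Suc i)) (peel_shape p q U) (peel p q U) j t)"
proof (rule set_eqI)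
  fix i
  show "i \<in> rows_before p q U j (Suc t) \<longleftrightarrow>
    i \<in> insert 0 (Suc ` rows_before (\<lambda>i. p (Suc i)) (peel_shape p q U) (peel p q U) j t)"
  proof (cases i)
    case 0
    then show ?thesis
      using j flagged_tableauxD(3)[OF U, of 0 j] by (auto simp: rows_before_def skew_cells_def)
  next
    case (Suc k)
    have "i \<in> rows_before p q U j (Suc t) \<longleftrightarrow>
        j < q (Suc k) \<or> (Suc k, j) \<in> skew_cells p q \<and> U (Suc k, j) \<le> t"
      using Suc by (auto simp: rows_before_def)
    also have "\<dots> \<longleftrightarrow> j < peel_shape p q U k \<or>
        (k, j) \<in> skew_cells (\<lambda>i. p (Suc i)) (peel_shape p q U) \<and> peel p q U (k, j) < t"
      using less_peel_shape_iff[OF U, of j k] skew_cells_peel_iff[OF U, of k j] peel_eq[OF U, of k j]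
        qp[of "Suc k"]
      by (cases "(Suc k, j) \<in> skew_cells p q") (auto simp: skew_cells_def)
    finally show ?thesis using Suc by (auto simp: rows_before_def)
  qed
qed

lemma finite_missing_entries: "finite (missing_entries p q' U)"
proof (rule finite_subset)
  show "missing_entries p q' U \<subseteq> prod.swap ` skew_cells p (\<lambda>_. 0)"
    by (force simp: missing_entries_def skew_cells_def)
  show "finite (prod.swap ` skew_cells p (\<lambda>_. 0))"
    by (intro finite_imageI finite_skew_cells[OF p])
qed

lemma finite_rows_before: "finite (rows_before p q U j t)"
proof (rule finite_subset)
  show "rows_before p q U j t \<subseteq> {..n}"
  proof
    fix i assume "i \<in> rows_before p q U j t"
    then have "0 < p i" using qp[of i] by (auto simp: rows_before_def skew_cells_def)
    then show "i \<in> {..n}" using shape_zero[OF p, of i] by (cases "i \<le> n") auto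
  qed
qed simp

text \<open>
  The missing zeros contribute the weight of the strip, and the positive missing entries are those of the
  peeled tableau, shifted by one.
\<close>

lemma tableau_weight_peel:
  assumes U: "U \<in> flagged_tableaux p q"
  shows "tableau_weight p q U = strip_weight n (p 0) q (peel_shape p q U) *
    tableau_weight (\<lambda>i. p (Suc i)) (peel_shape p q U) (peel p q U)"
proof -
  let ?M = "missing_entries p q U"
  let ?M' = "missing_entries (\<lambda>i. p (Suc i)) (peel_shape p q U) (peel p q U)"
  let ?g = "\<lambda>j t. int (p t) - int t + int (card (rows_before p q U j t)) - int j - 1"
  let ?J = "{j. (j, 0) \<in> ?M}"
  have M: "?M = (\<lambda>j. (j, 0)) ` ?J \<union> (\<lambda>(j, t). (j, Suc t)) ` ?M'"
  proof (rule set_eqI)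
    fix z :: "nat \<times> nat"
    obtain j t where z: "z = (j, t)" by (cases z)
    show "z \<in> ?M \<longleftrightarrow> z \<in> (\<lambda>j. (j, 0)) ` ?J \<union> (\<lambda>(j, t). (j, Suc t)) ` ?M'"
      using missing_entries_Suc_iff[OF U, of j "t - 1"] z by (cases t) (force simp: image_iff)+
  qed
  have fin: "finite ?M" by (rule finite_missing_entries)
  have fin': "finite ((\<lambda>j. (j, 0)) ` ?J \<union> (\<lambda>(j, t). (j, Suc t)) ` ?M')"
    using fin by (subst (asm) M)
  have "tableau_weight p q U =
      (\<Prod>(j, t)\<in>(\<lambda>j. (j, 0)) ` ?J. ?g j t) * (\<Prod>(j, t)\<in>(\<lambda>(j, t). (j, Suc t)) ` ?M'. ?g j t)"
    unfolding tableau_weight_def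
  proof (subst M, rule prod.union_disjoint)
    show "finite ((\<lambda>j. (j, 0::nat)) ` ?J)" "finite ((\<lambda>(j, t). (j, Suc t)) ` ?M')"
      using fin' by auto
  qed auto
  also have "(\<Prod>(j, t)\<in>(\<lambda>j. (j, 0)) ` ?J. ?g j t) = strip_weight n (p 0) q (peel_shape p q U)"
    unfolding prod_missing_0[OF U, symmetric] by (subst prod.reindex) (auto simp: inj_on_def)
  also have "(\<Prod>(j, t)\<in>(\<lambda>(j, t). (j, Suc t)) ` ?M'. ?g j t) =
      tableau_weight (\<lambda>i. p (Suc i)) (peel_shape p q U) (peel p q U)"
  proof -
    have "?g j (Suc t) = int (p (Suc t)) - int t +
        int (card (rows_before (\<lambda>i. p (Suc i)) (peel_shape p q U) (peel p q U) j t)) - int j - 1"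
      if "(j, t) \<in> ?M'" for j t
    proof -
      have "j < p (Suc t)" using that by (auto simp: missing_entries_def)
      then have "j < p 0" using shape_le[OF p, of 0 "Suc t"] by simp
      note eq = rows_before_Suc[OF U this]
      have "finite (Suc ` rows_before (\<lambda>i. p (Suc i)) (peel_shape p q U) (peel p q U) j t)"
        using finite_rows_before[of U j "Suc t"] unfolding eq by simp
      then show ?thesis unfolding eq by (simp add: card_image)
    qed
    then show ?thesis
      unfolding tableau_weight_def
      by (subst prod.reindex) (auto simp: inj_on_def intro!: prod.cong)
  qed
  finally show ?thesis .
qed

lemma sum_tableau_weight_branching:
  "(\<Sum>U\<in>flagged_tableaux p q. tableau_weight p q U) =
    (\<Sum>r | r \<in> interlacing n q \<and> (\<forall>i. r i \<le> p (Suc i)). strip_weight n (p 0) q r *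
      (\<Sum>U\<in>flagged_tableaux (\<lambda>i. p (Suc i)) r. tableau_weight (\<lambda>i. p (Suc i)) r U))"
proof -
  let ?R = "{r. r \<in> interlacing n q \<and> (\<forall>i. r i \<le> p (Suc i))}"
  let ?F = "\<lambda>r. flagged_tableaux (\<lambda>i. p (Suc i)) r"
  have "(\<Sum>U\<in>flagged_tableaux p q. tableau_weight p q U) =
      (\<Sum>(r, U)\<in>Sigma ?R ?F. strip_weight n (p 0) q r * tableau_weight (\<lambda>i. p (Suc i)) r U)"
    by (rule sum.reindex_bij_witness[where i = "\<lambda>(r, U). unpeel p q r U" and
          j = "\<lambda>U. (peel_shape p q U, peel p q U)"])
      (auto simp: unpeel_peel peel_unpeel peel_shape_unpeel unpeel_flagged peel_flagged
        peel_shape_interlacing peel_shape_le tableau_weight_peel)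
  also have "\<dots> = (\<Sum>r\<in>?R. \<Sum>U\<in>?F r. strip_weight n (p 0) q r * tableau_weight (\<lambda>i. p (Suc i)) r U)"
    by (rule sum.Sigma[symmetric])
      (auto simp: finite_interlacing finite_flagged_tableaux[OF shape_tail[OF p]])
  finally show ?thesis by (simp add: sum_distrib_left)
qed

end

text \<open>
  Peeling yields only inner shapes contained in the rows \<open>p 1, p 2, \<dots>\<close>, whereas the branching rule sums
  over all interlacing ones; vanishing closes the gap.
\<close>

theorem sum_tableau_weight_eq_shifted_schur:
  assumes "shape n p" "shape n q" "\<And>i. q i \<le> p i"
  shows "(\<Sum>U\<in>flagged_tableaux p q. tableau_weight p q U) = shifted_schur n p q"
  using assms
proof (induction n arbitrary: p q)
  case 0
  then have "skew_cells p q = {}" "\<And>U. missing_entries p q U = {}"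
    by (auto simp: skew_cells_def missing_entries_def shape_zero)
  then show ?case
    by (simp add: flagged_tableaux_def tableau_weight_def rows_weakly_increasing_def
        cols_strictly_increasing_def)
next
  case (Suc n)
  let ?p = "\<lambda>i. p (Suc i)"
  let ?R = "{r. r \<in> interlacing n q \<and> (\<forall>i. r i \<le> p (Suc i))}"
  have "(\<Sum>U\<in>flagged_tableaux p q. tableau_weight p q U) =
      (\<Sum>r\<in>?R. strip_weight n (p 0) q r * shifted_schur n ?p r)"
    unfolding sum_tableau_weight_branching[OF Suc.prems]
  proof (rule sum.cong[OF refl])
    fix r assume "r \<in> ?R"
    then have "(\<Sum>U\<in>flagged_tableaux ?p r. tableau_weight ?p r U) = shifted_schur n ?p r"
      by (intro Suc.IH shape_tail[OF Suc.prems(1)] interlacing_shape[of r n q]) auto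
    then show "strip_weight n (p 0) q r * (\<Sum>U\<in>flagged_tableaux ?p r. tableau_weight ?p r U) =
        strip_weight n (p 0) q r * shifted_schur n ?p r" by simp
  qed
  also have "\<dots> = shifted_schur (Suc n) p q"
    unfolding shifted_schur.simps
  proof (rule sum.mono_neutral_left)
    show "\<forall>r\<in>interlacing n q - ?R. strip_weight n (p 0) q r * shifted_schur n ?p r = 0"
    proof
      fix r assume r: "r \<in> interlacing n q - ?R"
      then obtain i where i: "p (Suc i) < r i" by (auto simp: not_le)
      moreover have "i < n"
        using i r shape_zero[OF interlacing_shape, of r n q i] by (cases "i < n") auto
      ultimately show "strip_weight n (p 0) q r * shifted_schur n ?p r = 0"
        using shifted_schur_vanishing[OF shape_tail[OF Suc.prems(1)], of i r] by simp
    qed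
  qed (auto simp: finite_interlacing)
  finally show ?case .
qed
section \<open>Counting standard fillings\<close>

definition standard_fillings :: "(nat \<times> nat) set \<Rightarrow> (nat \<times> nat \<Rightarrow> nat) set" where
  "standard_fillings D =
     {T \<in> D \<rightarrow>\<^sub>E {1..card D}. bij_betw T D {1..card D} \<and>
        rows_strictly_increasing D T \<and> cols_strictly_increasing D T}"

text \<open>
  The cells that may carry the smallest entry of a filling. Only cells of the same row or column are
  compared, exactly as in the monotonicity conditions.
\<close>

definition first_cells :: "(nat \<times> nat) set \<Rightarrow> (nat \<times> nat) set" where
  "first_cells D = {(i, j) \<in> D. (\<forall>j'. (i, j') \<in> D \<longrightarrow> j \<le> j') \<and> (\<forall>i'. (i', j) \<in> D \<longrightarrow> i \<le> i')}"

definition remove_one :: "(nat \<times> nat) set \<Rightarrow> (nat \<times> nat \<Rightarrow> nat) \<Rightarrow> nat \<times> nat \<Rightarrow> nat \<times> nat \<Rightarrow> nat" where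
  "remove_one D T u = (\<lambda>x\<in>D - {u}. T x - 1)"

definition insert_one :: "(nat \<times> nat) set \<Rightarrow> (nat \<times> nat \<Rightarrow> nat) \<Rightarrow> nat \<times> nat \<Rightarrow> nat \<times> nat \<Rightarrow> nat" where
  "insert_one D T u = (\<lambda>x\<in>D. if x = u then 1 else Suc (T x))"

lemma first_cells_subset: "first_cells D \<subseteq> D"
  by (auto simp: first_cells_def)

lemma finite_standard_fillings: "finite D \<Longrightarrow> finite (standard_fillings D)"
  by (rule finite_subset[of _ "D \<rightarrow>\<^sub>E {1..card D}"])
    (simp_all add: standard_fillings_def finite_PiE Collect_mono_iff subset_iff)

lemma standard_fillingsD:
  assumes "T \<in> standard_fillings D"
  shows "bij_betw T D {1..card D}"
    and "(i, j) \<in> D \<Longrightarrow> (i, j') \<in> D \<Longrightarrow> j < j' \<Longrightarrow> T (i, j) < T (i, j')"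
    and "(i, j) \<in> D \<Longrightarrow> (i', j) \<in> D \<Longrightarrow> i < i' \<Longrightarrow> T (i, j) < T (i', j)"
    and "u \<in> D \<Longrightarrow> 1 \<le> T u"
    and "u \<notin> D \<Longrightarrow> T u = undefined"
proof -
  have T: "T \<in> D \<rightarrow>\<^sub>E {1..card D}" using assms by (simp add: standard_fillings_def)
  show "u \<in> D \<Longrightarrow> 1 \<le> T u" using PiE_mem[OF T, of u] by simp
  show "u \<notin> D \<Longrightarrow> T u = undefined" by (rule PiE_arb[OF T])
qed (use assms in
  \<open>simp_all add: standard_fillings_def rows_strictly_increasing_def cols_strictly_increasing_def\<close>)

lemma cell_of_one_first:
  assumes T: "T \<in> standard_fillings D" and u: "u \<in> D" "T u = 1"
  shows "u \<in> first_cells D"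
proof -
  obtain i j where ij: "u = (i, j)" by (cases u)
  have "j \<le> j'" if "(i, j') \<in> D" for j'
  proof (rule ccontr)
    assume "\<not> j \<le> j'"
    then have "T (i, j') < T (i, j)"
      using standard_fillingsD(2)[OF T, of i j' j] that u ij by simp
    then show False using standard_fillingsD(4)[OF T that] u ij by simp
  qed
  moreover have "i \<le> i'" if "(i', j) \<in> D" for i'
  proof (rule ccontr)
    assume "\<not> i \<le> i'"
    then have "T (i', j) < T (i, j)"
      using standard_fillingsD(3)[OF T, of i' j i] that u ij by simp
    then show False using standard_fillingsD(4)[OF T that] u ij by simp
  qed
  ultimately show ?thesis using u ij by (auto simp: first_cells_def)
qed

lemma remove_one_standard:
  assumes fin: "finite D" and T: "T \<in> standard_fillings D" and u: "u \<in> D" "T u = 1"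
  shows "remove_one D T u \<in> standard_fillings (D - {u})"
proof -
  let ?R = "remove_one D T u"
  have card: "card D = Suc (card (D - {u}))" using card_Suc_Diff1[OF fin u(1)] by (rule sym)
  note bij = standard_fillingsD(1)[OF T]
  have "bij_betw T (D - {u}) ({1..card D} - {1})"
  proof (rule bij_betw_DiffI[OF bij])
    show "bij_betw T {u} {1}" using u by simp
    show "{1} \<subseteq> {1..card D}" unfolding card by simp
  qed (use u in simp)
  moreover have "{1..card D} - {1} = {2..Suc (card (D - {u}))}" unfolding card by auto
  ultimately have "bij_betw T (D - {u}) {2..Suc (card (D - {u}))}" by simp
  moreover have "bij_betw (\<lambda>k::nat. k - 1) {2..Suc (card (D - {u}))} {1..card (D - {u})}"
    by (rule bij_betwI[where g = Suc]) auto
  ultimately have "bij_betw ((\<lambda>k. k - 1) \<circ> T) (D - {u}) {1..card (D - {u})}"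
    by (rule bij_betw_trans)
  then have bij': "bij_betw ?R (D - {u}) {1..card (D - {u})}"
    by (subst bij_betw_cong[where g = "(\<lambda>k. k - 1) \<circ> T"]) (auto simp: remove_one_def)
  then have "?R \<in> D - {u} \<rightarrow>\<^sub>E {1..card (D - {u})}"
    using bij_betwE[OF bij'] by (intro PiE_I) (auto simp: remove_one_def)
  have pos: "1 < T v" if "v \<in> D - {u}" for v
  proof -
    have "T v \<noteq> T u"
      using inj_onD[OF bij_betw_imp_inj_on[OF bij], of v u] that u(1) by blast
    moreover have "1 \<le> T v" using that by (intro standard_fillingsD(4)[OF T]) simp
    ultimately show ?thesis using u(2) by linarith
  qed
  have "rows_strictly_increasing (D - {u}) ?R"
    unfolding rows_strictly_increasing_def
  proof (intro allI impI)
    fix i j j' assume a: "(i, j) \<in> D - {u}" "(i, j') \<in> D - {u}" "j < j'"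
    then have "T (i, j) < T (i, j')" by (intro standard_fillingsD(2)[OF T]) auto
    then show "?R (i, j) < ?R (i, j')" using a pos[OF a(1)] by (simp add: remove_one_def)
  qed
  moreover have "cols_strictly_increasing (D - {u}) ?R"
    unfolding cols_strictly_increasing_def
  proof (intro allI impI)
    fix i i' j assume a: "(i, j) \<in> D - {u}" "(i', j) \<in> D - {u}" "i < i'"
    then have "T (i, j) < T (i', j)" by (intro standard_fillingsD(3)[OF T]) auto
    then show "?R (i, j) < ?R (i', j)" using a pos[OF a(1)] by (simp add: remove_one_def)
  qed
  ultimately show ?thesis
    using bij' \<open>?R \<in> _\<close> by (simp add: standard_fillings_def)
qed

lemma insert_one_standard:
  assumes fin: "finite D" and u: "u \<in> first_cells D" and T: "T \<in> standard_fillings (D - {u})"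
  shows "insert_one D T u \<in> standard_fillings D"
proof -
  let ?I = "insert_one D T u"
  have uD: "u \<in> D" using u first_cells_subset by blast
  have card: "card D = Suc (card (D - {u}))" using card_Suc_Diff1[OF fin uD] by (rule sym)
  note bij = standard_fillingsD(1)[OF T]
  have "bij_betw Suc {1..card (D - {u})} {2..card D}"
    unfolding card by (rule bij_betwI[where g = "\<lambda>k. k - 1"]) auto
  with bij have "bij_betw (Suc \<circ> T) (D - {u}) {2..card D}" by (rule bij_betw_trans)
  then have "bij_betw ?I (D - {u}) {2..card D}"
    by (subst bij_betw_cong[where g = "Suc \<circ> T"]) (auto simp: insert_one_def)
  moreover have "bij_betw ?I {u} {1}" using uD by (simp add: insert_one_def)
  ultimately have "bij_betw ?I ((D - {u}) \<union> {u}) ({2..card D} \<union> {1})"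
    by (rule bij_betw_combine) auto
  moreover have "(D - {u}) \<union> {u} = D" using uD by blast
  moreover have "{2..card D} \<union> {1} = {1..card D}" unfolding card by auto
  ultimately have bij': "bij_betw ?I D {1..card D}" by simp
  then have "?I \<in> D \<rightarrow>\<^sub>E {1..card D}"
    using bij_betwE[OF bij'] by (intro PiE_I) (auto simp: insert_one_def)
  have pos: "0 < T v" if "v \<in> D - {u}" for v
    using standard_fillingsD(4)[OF T that] by simp
  have val: "?I v = Suc (T v)" if "v \<in> D - {u}" for v using that by (simp add: insert_one_def)
  have valu: "?I u = 1" using uD by (simp add: insert_one_def)
  have "rows_strictly_increasing D ?I"
    unfolding rows_strictly_increasing_def
  proof (intro allI impI)
    fix i j j' assume a: "(i, j) \<in> D" "(i, j') \<in> D" "j < j'"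
    then have "(i, j') \<noteq> u" using u by (auto simp: first_cells_def)
    show "?I (i, j) < ?I (i, j')"
    proof (cases "(i, j) = u")
      case True
      then show ?thesis using valu val pos a \<open>(i, j') \<noteq> u\<close> by simp
    next
      case False
      then have "T (i, j) < T (i, j')"
        using a \<open>(i, j') \<noteq> u\<close> by (intro standard_fillingsD(2)[OF T]) auto
      then show ?thesis using val False a \<open>(i, j') \<noteq> u\<close> by simp
    qed
  qed
  moreover have "cols_strictly_increasing D ?I"
    unfolding cols_strictly_increasing_def
  proof (intro allI impI)
    fix i i' j assume a: "(i, j) \<in> D" "(i', j) \<in> D" "i < i'"
    then have "(i', j) \<noteq> u" using u by (auto simp: first_cells_def)
    show "?I (i, j) < ?I (i', j)"
    proof (cases "(i, j) = u")
      case True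
      then show ?thesis using valu val pos a \<open>(i', j) \<noteq> u\<close> by simp
    next
      case False
      then have "T (i, j) < T (i', j)"
        using a \<open>(i', j) \<noteq> u\<close> by (intro standard_fillingsD(3)[OF T]) auto
      then show ?thesis using val False a \<open>(i', j) \<noteq> u\<close> by simp
    qed
  qed
  ultimately show ?thesis
    using bij' \<open>?I \<in> _\<close> by (simp add: standard_fillings_def)
qed

text \<open>
  Deleting the cell with entry 1 and lowering the other entries can be undone for any choice of a first cell.
\<close>

lemma card_standard_fillings:
  assumes fin: "finite D" and "D \<noteq> {}"
  shows "card (standard_fillings D) = (\<Sum>u\<in>first_cells D. card (standard_fillings (D - {u})))"
proof -
  let ?S = "SIGMA u:first_cells D. standard_fillings (D - {u})"
  let ?u = "\<lambda>T. inv_into D T 1"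
  have u: "?u T \<in> D" "T (?u T) = 1" if "T \<in> standard_fillings D" for T
  proof -
    have "1 \<in> {1..card D}" using assms by (simp add: Suc_le_eq card_gt_0_iff)
    then have "1 \<in> T ` D" using bij_betw_imp_surj_on[OF standard_fillingsD(1)[OF that]] by blast
    then show "?u T \<in> D" "T (?u T) = 1" by (rule inv_into_into, rule f_inv_into_f)
  qed
  have "bij_betw (\<lambda>T. (?u T, remove_one D T (?u T))) (standard_fillings D) ?S"
  proof (rule bij_betwI[where g = "\<lambda>(u, T). insert_one D T u"])
    show "(\<lambda>T. (?u T, remove_one D T (?u T))) \<in> standard_fillings D \<rightarrow> ?S"
    proof
      fix T assume T: "T \<in> standard_fillings D"
      show "(?u T, remove_one D T (?u T)) \<in> ?S"
        using cell_of_one_first[OF T u[OF T]] remove_one_standard[OF fin T u[OF T]] by (rule SigmaI)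
    qed
    show "(\<lambda>(u, T). insert_one D T u) \<in> ?S \<rightarrow> standard_fillings D"
    proof
      fix z assume "z \<in> ?S"
      then show "(case z of (u, T) \<Rightarrow> insert_one D T u) \<in> standard_fillings D"
        using insert_one_standard[OF fin, of "fst z" "snd z"] by (cases z) simp
    qed
  next
    fix T assume T: "T \<in> standard_fillings D"
    have "insert_one D (remove_one D T (?u T)) (?u T) x = T x" for x
    proof (cases "x \<in> D")
      case True
      then have "1 \<le> T x" by (rule standard_fillingsD(4)[OF T])
      then show ?thesis using True u[OF T] by (auto simp: insert_one_def remove_one_def)
    next
      case False
      then show ?thesis
        using standard_fillingsD(5)[OF T] by (simp add: insert_one_def)
    qed
    then show "(case (?u T, remove_one D T (?u T)) of (u, T) \<Rightarrow> insert_one D T u) = T"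
      by (simp add: fun_eq_iff)
  next
    fix z assume "z \<in> ?S"
    then obtain v T where z: "z = (v, T)" "v \<in> first_cells D" "T \<in> standard_fillings (D - {v})"
      by blast
    let ?I = "insert_one D T v"
    have v: "v \<in> D" using z(2) first_cells_subset by blast
    have I: "?I \<in> standard_fillings D" by (rule insert_one_standard[OF fin z(2,3)])
    have "?I v = 1" using v by (simp add: insert_one_def)
    moreover have "inj_on ?I D" by (rule bij_betw_imp_inj_on[OF standard_fillingsD(1)[OF I]])
    ultimately have uv: "?u ?I = v" using inv_into_f_f[of ?I D v] v by simp
    have "remove_one D ?I v = T"
    proof
      fix x show "remove_one D ?I v x = T x"
        using standard_fillingsD(5)[OF z(3), of x]
        by (cases "x \<in> D - {v}") (auto simp: remove_one_def insert_one_def)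
    qed
    then show "(\<lambda>T. (?u T, remove_one D T (?u T))) (case z of (u, T) \<Rightarrow> insert_one D T u) = z"
      using z(1) uv by simp
  qed
  then have "card (standard_fillings D) = card ?S" by (rule bij_betw_same_card)
  also have "\<dots> = (\<Sum>u\<in>first_cells D. card (standard_fillings (D - {u})))"
    using fin finite_subset[OF first_cells_subset fin] by (intro card_SigmaI) (auto intro: finite_standard_fillings)
  finally show ?thesis .
qed

text \<open>
  Being leftmost in row \<open>i\<close> singles out the cell \<open>(i, q i)\<close>. Being topmost in its column says that row
  \<open>i - 1\<close> of \<open>q\<close>, if there is one, is longer than row \<open>i\<close>, so that the cell can be added.
\<close>

lemma first_cells_skew_cells:
  assumes p: "shape n p" and q: "shape n q" and qp: "\<And>i. q i \<le> p i"
  shows "first_cells (skew_cells p q) =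
    (\<lambda>i. (i, q i)) ` {i. i < n \<and> shape n (add_box q i) \<and> q i < p i}"
proof (rule set_eqI)
  fix u :: "nat \<times> nat"
  obtain i j where u: "u = (i, j)" by (cases u)
  have "(i, j) \<in> first_cells (skew_cells p q) \<longleftrightarrow>
    j = q i \<and> i < n \<and> shape n (add_box q i) \<and> q i < p i"
  proof
    assume a: "(i, j) \<in> first_cells (skew_cells p q)"
    then have ij: "q i \<le> j" "j < p i" by (auto simp: first_cells_def skew_cells_def)
    then have "(i, q i) \<in> skew_cells p q" by (simp add: skew_cells_def)
    then have j: "j = q i" using a ij by (auto simp: first_cells_def)
    have i: "i < n" using ij shape_zero[OF p, of i] by (cases "i < n") auto
    have "i = 0 \<or> q i < q (i - 1)"
    proof (rule ccontr)
      assume neg: "\<not> ?thesis"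
      then obtain k where k: "i = Suc k" by (cases i) auto
      then have "(k, j) \<in> skew_cells p q"
        using neg j ij shape_Suc_le[OF p, of k] by (auto simp: skew_cells_def)
      then show False using a k by (auto simp: first_cells_def)
    qed
    then show "j = q i \<and> i < n \<and> shape n (add_box q i) \<and> q i < p i"
      using i j ij shape_add_box_iff[OF q i] by simp
  next
    assume a: "j = q i \<and> i < n \<and> shape n (add_box q i) \<and> q i < p i"
    then have *: "i = 0 \<or> q i < q (i - 1)" using shape_add_box_iff[OF q] by blast
    have "i \<le> i'" if "(i', j) \<in> skew_cells p q" for i'
    proof (rule ccontr)
      assume "\<not> i \<le> i'"
      then have "q (i - 1) \<le> q i'" "0 < i" using shape_le[OF q, of i' "i - 1"] by auto
      then show False using * a that by (auto simp: skew_cells_def)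
    qed
    then show "(i, j) \<in> first_cells (skew_cells p q)"
      using a by (auto simp: first_cells_def skew_cells_def)
  qed
  then show "u \<in> first_cells (skew_cells p q) \<longleftrightarrow>
      u \<in> (\<lambda>i. (i, q i)) ` {i. i < n \<and> shape n (add_box q i) \<and> q i < p i}"
    using u by auto
qed

lemma skew_cells_add_box: "skew_cells p (add_box q i) = skew_cells p q - {(i, q i)}"
  by (auto simp: skew_cells_def add_box_def split: if_splits)

lemma card_skew_cells:
  assumes p: "shape n p" and qp: "\<And>i. q i \<le> p i"
  shows "int (card (skew_cells p q)) = (\<Sum>i<n. int (p i)) - (\<Sum>i<n. int (q i))"
proof -
  have "skew_cells p q = (SIGMA i:{..<n}. {q i..<p i})"
  proof (rule set_eqI)
    fix u :: "nat \<times> nat"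
    show "u \<in> skew_cells p q \<longleftrightarrow> u \<in> (SIGMA i:{..<n}. {q i..<p i})"
      using shape_zero[OF p, of "fst u"]
      by (cases u, cases "fst u < n") (auto simp: skew_cells_def)
  qed
  then show ?thesis using qp by (simp add: of_nat_diff sum_subtractf)
qed

text \<open>
  Passage from rows and columns counted from 0 to rows and columns counted from 1.
\<close>

definition shift_cell :: "nat \<times> nat \<Rightarrow> nat \<times> nat" where
  "shift_cell = (\<lambda>(i, j). (Suc i, Suc j))"

lemma shift_cell_simp [simp]: "shift_cell (i, j) = (Suc i, Suc j)"
  by (simp add: shift_cell_def)

lemma inj_shift_cell: "inj shift_cell"
  by (auto simp: inj_on_def shift_cell_def)

lemma first_cells_shift: "first_cells (shift_cell ` D) = shift_cell ` first_cells D"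
proof -
  have mem: "(i, j) \<in> shift_cell ` D \<longleftrightarrow> (\<exists>i' j'. i = Suc i' \<and> j = Suc j' \<and> (i', j') \<in> D)" for i j D
    by (force simp: shift_cell_def)
  show ?thesis
    by (rule set_eqI) (auto simp: first_cells_def mem; metis Suc_le_mono)
qed

text \<open>
  Both sides satisfy the recursion over the cells that can be added to \<open>q\<close>. The Pieri rule supplies the factor
  \<open>|p| - |q|\<close>, the number of cells of \<open>p/q\<close>, which turns one factorial into the next. Its extra terms, for
  cells outside \<open>p\<close>, vanish.
\<close>

theorem card_standard_fillings_shifted_schur:
  assumes p: "shape n p" and "shape n q" and "\<And>i. q i \<le> p i"
  shows "int (card (standard_fillings (shift_cell ` skew_cells p q))) * shifted_schur n p p =
    fact (card (skew_cells p q)) * shifted_schur n p q"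
  using assms(2,3)
proof (induction "card (skew_cells p q)" arbitrary: q)
  case 0
  then have empty: "skew_cells p q = {}" using finite_skew_cells[OF p] by auto
  have "q = p"
  proof
    fix i show "q i = p i"
      using empty 0(3)[of i] by (cases "q i < p i") (auto simp: skew_cells_def)
  qed
  moreover have "standard_fillings {} = {\<lambda>_. undefined}"
    by (auto simp: standard_fillings_def rows_strictly_increasing_def cols_strictly_increasing_def
        bij_betw_def)
  ultimately show ?case using empty by simp
next
  case (Suc N)
  note q = Suc.prems(1) and qp = Suc.prems(2)
  let ?D = "skew_cells p q"
  let ?A = "{i. i < n \<and> shape n (add_box q i)}"
  let ?B = "{i. i < n \<and> shape n (add_box q i) \<and> q i < p i}"
  have fin: "finite ?D" by (rule finite_skew_cells[OF p])
  have ne: "?D \<noteq> {}" using Suc.hyps(2) by auto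
  have step: "int (card (standard_fillings (shift_cell ` (?D - {(i, q i)})))) * shifted_schur n p p =
      fact N * shifted_schur n p (add_box q i)" if i: "i \<in> ?B" for i
  proof -
    have "(i, q i) \<in> ?D" using i by (simp add: skew_cells_def)
    then have "N = card (skew_cells p (add_box q i))"
      using Suc.hyps(2) fin by (simp add: skew_cells_add_box)
    moreover have "add_box q i k \<le> p k" for k
      using i qp[of k] by (auto simp: add_box_def)
    ultimately show ?thesis
      using Suc.hyps(1)[of "add_box q i"] i by (simp add: skew_cells_add_box)
  qed
  have "int (card (standard_fillings (shift_cell ` ?D))) =
      (\<Sum>i\<in>?B. int (card (standard_fillings (shift_cell ` (?D - {(i, q i)})))))"
  proof -
    have "card (standard_fillings (shift_cell ` ?D)) =
        (\<Sum>u\<in>first_cells ?D. card (standard_fillings (shift_cell ` ?D - {shift_cell u})))"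
      using fin ne inj_shift_cell
      by (simp add: card_standard_fillings first_cells_shift sum.reindex inj_on_subset[of _ UNIV])
    also have "\<dots> = (\<Sum>u\<in>first_cells ?D. card (standard_fillings (shift_cell ` (?D - {u}))))"
      by (simp add: image_set_diff[OF inj_shift_cell])
    also have "\<dots> = (\<Sum>i\<in>?B. card (standard_fillings (shift_cell ` (?D - {(i, q i)}))))"
      unfolding first_cells_skew_cells[OF p q qp]
      by (subst sum.reindex) (auto simp: inj_on_def)
    finally show ?thesis by simp
  qed
  then have "int (card (standard_fillings (shift_cell ` ?D))) * shifted_schur n p p =
      (\<Sum>i\<in>?B. int (card (standard_fillings (shift_cell ` (?D - {(i, q i)})))) * shifted_schur n p p)"
    by (simp only: sum_distrib_right)
  also have "\<dots> = (\<Sum>i\<in>?B. fact N * shifted_schur n p (add_box q i))"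
    by (rule sum.cong[OF refl step])
  also have "\<dots> = (\<Sum>i\<in>?A. fact N * shifted_schur n p (add_box q i))"
  proof (rule sum.mono_neutral_left)
    show "\<forall>i\<in>?A - ?B. fact N * shifted_schur n p (add_box q i) = 0"
    proof
      fix i assume "i \<in> ?A - ?B"
      then have "i < n" "p i < add_box q i i" using qp[of i] by (auto simp: add_box_def)
      then show "fact N * shifted_schur n p (add_box q i) = 0"
        using shifted_schur_vanishing[OF p] by simp
    qed
  qed auto
  also have "\<dots> = fact N * (int (card ?D) * shifted_schur n p q)"
    using shifted_schur_pieri[OF q, of p] card_skew_cells[OF p qp]
    by (simp add: sum_distrib_left[symmetric])
  also have "\<dots> = fact (card ?D) * shifted_schur n p q"
    unfolding Suc.hyps(2)[symmetric] by simp
  finally show ?case .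
qed
section \<open>Partitions as lists\<close>

definition row_length :: "nat list \<Rightarrow> nat \<Rightarrow> nat" where
  "row_length la i = part la (Suc i)"

lemma shape_row_length:
  assumes "is_partition la"
  shows "shape (length la) (row_length la)"
proof (rule shapeI)
  fix i
  show "row_length la (Suc i) \<le> row_length la i"
    using assms by (auto simp: row_length_def part_def is_partition_def sorted_wrt_iff_nth_less)
qed (simp add: row_length_def part_def)

lemma diagram_iff: "(a, b) \<in> diagram la \<longleftrightarrow> (\<exists>i j. a = Suc i \<and> b = Suc j \<and> j < row_length la i)"
proof
  assume "(a, b) \<in> diagram la"
  then have "a = Suc (a - 1) \<and> b = Suc (b - 1) \<and> b - 1 < row_length la (a - 1)"
    by (auto simp: diagram_def row_length_def)
  then show "\<exists>i j. a = Suc i \<and> b = Suc j \<and> j < row_length la i" by blast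
qed (auto simp: diagram_def row_length_def part_def split: if_splits)

lemma skew_diagram_iff:
  "(a, b) \<in> skew_diagram la mu \<longleftrightarrow>
    (\<exists>i j. a = Suc i \<and> b = Suc j \<and> (i, j) \<in> skew_cells (row_length la) (row_length mu))"
  by (auto simp: skew_diagram_def diagram_iff skew_cells_def)

lemma skew_diagram_eq:
  "skew_diagram la mu = shift_cell ` skew_cells (row_length la) (row_length mu)"
  by (rule set_eqI) (force simp: skew_diagram_iff shift_cell_def)

lemma less_card_column_iff:
  assumes "shape n p"
  shows "i < card {i. j < p i} \<longleftrightarrow> j < p i"
proof -
  have "{i. j < p i} \<subseteq> {..<n}" using shape_zero[OF assms] by (force simp: not_less[symmetric])
  then have "finite {i. j < p i}" by (rule finite_subset) simp
  moreover have "a \<in> {i. j < p i}" if "b \<in> {i. j < p i}" "a < b" for a b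
    using that shape_le[OF assms, of a b] by auto
  ultimately show ?thesis using less_card_down_closed_iff[of "{i. j < p i}" i] by simp
qed

lemma part_conj_partition:
  assumes "is_partition la"
  shows "part (conj_partition la) (Suc j) = card {i. j < row_length la i}"
proof (cases "j < row_length la 0")
  case True
  have "{i. 1 \<le> i \<and> i \<le> length la \<and> Suc j \<le> part la i} = Suc ` {i. j < row_length la i}"
  proof (rule set_eqI)
    fix i
    show "i \<in> {i. 1 \<le> i \<and> i \<le> length la \<and> Suc j \<le> part la i} \<longleftrightarrow>
        i \<in> Suc ` {i. j < row_length la i}"
      by (cases i) (auto simp: row_length_def part_def image_iff split: if_splits)
  qed
  then have col: "card {i. 1 \<le> i \<and> i \<le> length la \<and> Suc j \<le> part la i} =
      card {i. j < row_length la i}"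
    by (simp only: card_image inj_Suc inj_on_subset[OF inj_Suc subset_UNIV])
  have len: "j < length [1..<Suc (part la 1)]" using True by (simp add: row_length_def)
  then have "part (conj_partition la) (Suc j) = conj_partition la ! j"
    by (simp add: part_def conj_partition_def)
  also have "\<dots> = card {i. 1 \<le> i \<and> i \<le> length la \<and> [1..<Suc (part la 1)] ! j \<le> part la i}"
    unfolding conj_partition_def by (rule nth_map[OF len])
  also have "[1..<Suc (part la 1)] ! j = Suc j"
    using True by (subst nth_upt) (auto simp: row_length_def)
  finally show ?thesis unfolding col .
next
  case False
  then have "{i. j < row_length la i} = {}"
    using shape_le[OF shape_row_length[OF assms], of 0] by (auto simp: not_less intro: order_trans)
  then have "card {i. j < row_length la i} = 0" by (simp only: card.empty)
  then show ?thesis using False by (simp add: part_def conj_partition_def row_length_def)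
qed

context
  fixes la mu :: "nat list"
  assumes la: "is_partition la" and mu: "is_partition mu" and sub: "diagram mu \<subseteq> diagram la"
begin

lemma row_length_mono: "row_length mu i \<le> row_length la i"
proof (cases "row_length mu i")
  case (Suc k)
  then have "(Suc i, Suc k) \<in> diagram mu" by (simp add: diagram_iff)
  then have "(Suc i, Suc k) \<in> diagram la" using sub by blast
  then show ?thesis using Suc by (simp add: diagram_iff)
qed simp

lemma shape_inner: "shape (length la) (row_length mu)"
proof (rule shapeI)
  show "row_length mu (Suc i) \<le> row_length mu i" for i
    by (rule shape_Suc_le[OF shape_row_length[OF mu]])
  show "row_length mu i = 0" if "length la \<le> i" for i
    using row_length_mono[of i] shape_zero[OF shape_row_length[OF la] that] by simp
qed

lemma down_shift_flagged:
  assumes T: "T \<in> SF la mu"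
  shows "(\<lambda>(i, j)\<in>skew_cells (row_length la) (row_length mu). T (Suc i, Suc j) - 1)
    \<in> flagged_tableaux (row_length la) (row_length mu)"
proof -
  let ?K = "skew_cells (row_length la) (row_length mu)"
  let ?U = "\<lambda>(i, j)\<in>?K. T (Suc i, Suc j) - 1"
  have cell: "(Suc i, Suc j) \<in> skew_diagram la mu" if "(i, j) \<in> ?K" for i j
    using that by (simp add: skew_diagram_iff)
  have pos: "1 \<le> T u" if "u \<in> skew_diagram la mu" for u
  proof -
    have "T \<in> skew_diagram la mu \<rightarrow>\<^sub>E {1..}" using T by (simp add: SF_def SSYT_def)
    from PiE_mem[OF this that] show ?thesis by simp
  qed
  have "rows_weakly_increasing ?K ?U"
    unfolding rows_weakly_increasing_def
  proof (intro allI impI)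
    fix i j j' assume a: "(i, j) \<in> ?K" "(i, j') \<in> ?K" "j < j'"
    then have "T (Suc i, Suc j) \<le> T (Suc i, Suc j')"
      using T cell[OF a(1)] cell[OF a(2)] unfolding SF_def SSYT_def rows_weakly_increasing_def
      by blast
    then show "?U (i, j) \<le> ?U (i, j')" using a by simp
  qed
  moreover have "cols_strictly_increasing ?K ?U"
    unfolding cols_strictly_increasing_def
  proof (intro allI impI)
    fix i i' j assume a: "(i, j) \<in> ?K" "(i', j) \<in> ?K" "i < i'"
    then have "T (Suc i, Suc j) < T (Suc i', Suc j)"
      using T cell[OF a(1)] cell[OF a(2)] unfolding SF_def SSYT_def cols_strictly_increasing_def
      by simp
    then show "?U (i, j) < ?U (i', j)" using a pos[OF cell[OF a(1)]] by simp
  qed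
  moreover have "?U (i, j) \<le> i" if "(i, j) \<in> ?K" for i j
  proof -
    have "T (Suc i, Suc j) \<le> Suc i" using T cell[OF that] unfolding SF_def by blast
    then show ?thesis using that by simp
  qed
  ultimately show ?thesis by (auto simp: flagged_tableaux_def)
qed

lemma up_shift_SF:
  assumes U: "U \<in> flagged_tableaux (row_length la) (row_length mu)"
  shows "(\<lambda>(a, b)\<in>skew_diagram la mu. Suc (U (a - 1, b - 1))) \<in> SF la mu"
proof -
  note D = flagged_tableauxD[OF U]
  let ?T = "\<lambda>(a, b)\<in>skew_diagram la mu. Suc (U (a - 1, b - 1))"
  have "rows_weakly_increasing (skew_diagram la mu) ?T"
    unfolding rows_weakly_increasing_def
  proof (intro allI impI)
    fix a b b' assume "(a, b) \<in> skew_diagram la mu" "(a, b') \<in> skew_diagram la mu" "b < b'"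
    then show "?T (a, b) \<le> ?T (a, b')"
      using D(1)[of "a - 1" "b - 1" "b' - 1"] by (auto simp: skew_diagram_iff)
  qed
  moreover have "cols_strictly_increasing (skew_diagram la mu) ?T"
    unfolding cols_strictly_increasing_def
  proof (intro allI impI)
    fix a a' b assume "(a, b) \<in> skew_diagram la mu" "(a', b) \<in> skew_diagram la mu" "a < a'"
    then show "?T (a, b) < ?T (a', b)"
      using D(2)[of "a - 1" "b - 1" "a' - 1"] by (auto simp: skew_diagram_iff)
  qed
  moreover have "?T (a, b) \<le> a" if "(a, b) \<in> skew_diagram la mu" for a b
    using that D(3)[of "a - 1" "b - 1"] by (auto simp: skew_diagram_iff)
  moreover have "?T \<in> skew_diagram la mu \<rightarrow>\<^sub>E {1..}" by auto
  ultimately show ?thesis by (auto simp: SF_def SSYT_def)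
qed

text \<open>
  Counted from 0, the bound on \<open>t\<close> by the length of column \<open>j\<close> becomes \<open>j < p t\<close> by conjugation, and the bound on \<open>j\<close> follows from it.
\<close>

lemma missing_shift:
  assumes T: "T \<in> SF la mu"
  defines "U \<equiv> \<lambda>(i, j)\<in>skew_cells (row_length la) (row_length mu). T (Suc i, Suc j) - 1"
  shows "missing la mu T = shift_cell ` missing_entries (row_length la) (row_length mu) U"
proof (rule set_eqI)
  fix z :: "nat \<times> nat"
  obtain b a where z: "z = (b, a)" by (cases z)
  have T': "T \<in> skew_diagram la mu \<rightarrow>\<^sub>E {1..}" using T by (simp add: SF_def SSYT_def)
  have val: "T (Suc i, Suc j) = Suc (U (i, j))"
    if "(i, j) \<in> skew_cells (row_length la) (row_length mu)" for i j
  proof -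
    have "(Suc i, Suc j) \<in> skew_diagram la mu" using that by (simp add: skew_diagram_iff)
    from PiE_mem[OF T' this] show ?thesis using that by (simp add: U_def)
  qed
  have len: "length (conj_partition la) = row_length la 0"
    by (simp add: conj_partition_def row_length_def)
  show "z \<in> missing la mu T \<longleftrightarrow>
      z \<in> shift_cell ` missing_entries (row_length la) (row_length mu) U"
  proof (cases "\<exists>j t. b = Suc j \<and> a = Suc t")
    case True
    then obtain j t where jt: "b = Suc j" "a = Suc t" by blast
    have "(\<exists>i. (i, b) \<in> skew_diagram la mu \<and> T (i, b) = a) \<longleftrightarrow>
        (\<exists>i. (i, j) \<in> skew_cells (row_length la) (row_length mu) \<and> U (i, j) = t)"
      using val unfolding jt skew_diagram_iff by fastforce
    moreover have "t < part (conj_partition la) (Suc j) \<longleftrightarrow> j < row_length la t"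
      unfolding part_conj_partition[OF la]
      by (rule less_card_column_iff[OF shape_row_length[OF la]])
    moreover have "j < row_length la 0" if "j < row_length la t"
      using that shape_le[OF shape_row_length[OF la], of 0 t] by simp
    ultimately have "z \<in> missing la mu T \<longleftrightarrow>
        (j, t) \<in> missing_entries (row_length la) (row_length mu) U"
      unfolding z missing_def missing_entries_def mem_Collect_eq prod.case len
      using jt by (auto simp: Suc_le_eq)
    also have "\<dots> \<longleftrightarrow> z \<in> shift_cell ` missing_entries (row_length la) (row_length mu) U"
      using inj_image_mem_iff[OF inj_shift_cell, of "(j, t)"] z jt by simp
    finally show ?thesis .
  next
    case False
    then have "z \<notin> missing la mu T" using z by (cases a; cases b) (auto simp: missing_def)
    moreover have "z \<notin> shift_cell ` missing_entries (row_length la) (row_length mu) U"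
      using False z by (auto simp: shift_cell_def)
    ultimately show ?thesis by blast
  qed
qed

text \<open>
  Let \<open>c\<close> be the number of rows that hold a cell of \<open>mu\<close> or an entry below the missing one in column \<open>j\<close>. These
  are the first \<open>c\<close> rows, so \<open>c\<close> qualifies as the insertion row. A candidate \<open>k\<close> smaller than \<open>c\<close>
  fails at row \<open>k\<close>, counted from 0, and a larger one fails at row \<open>c\<close>: the bounds \<open>\<mu>'\<^sub>j \<le> k \<le> \<lambda>'\<^sub>j\<close>
  ensure that these rows have a cell of the skew shape in column \<open>j\<close>.
\<close>

lemma insertion_row_eq:
  assumes T: "T \<in> SF la mu"
  defines "U \<equiv> \<lambda>(i, j)\<in>skew_cells (row_length la) (row_length mu). T (Suc i, Suc j) - 1"
  assumes jt: "(j, t) \<in> missing_entries (row_length la) (row_length mu) U"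
  shows "insertion_row la mu T (Suc j) (Suc t) =
    card (rows_before (row_length la) (row_length mu) U j t)"
proof -
  let ?p = "row_length la" and ?q = "row_length mu"
  let ?A = "rows_before ?p ?q U j t"
  note p = shape_row_length[OF la] and q = shape_row_length[OF mu]
  have T': "T \<in> skew_diagram la mu \<rightarrow>\<^sub>E {1..}" using T by (simp add: SF_def SSYT_def)
  have val: "T (Suc i, Suc j) = Suc (U (i, j))" if "(i, j) \<in> skew_cells ?p ?q" for i
  proof -
    have "(Suc i, Suc j) \<in> skew_diagram la mu" using that by (simp add: skew_diagram_iff)
    from PiE_mem[OF T' this] show ?thesis using that by (simp add: U_def)
  qed
  have U: "U \<in> flagged_tableaux ?p ?q" unfolding U_def by (rule down_shift_flagged[OF T])
  have ne: "U (i, j) \<noteq> t" if "(i, j) \<in> skew_cells ?p ?q" for i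
    using jt that by (auto simp: missing_entries_def)
  have Ap: "?A \<subseteq> {i. j < ?p i}"
    using row_length_mono by (auto simp: rows_before_def skew_cells_def intro: less_le_trans)
  have colp: "i < card {i. j < ?p i} \<longleftrightarrow> j < ?p i" for i by (rule less_card_column_iff[OF p])
  have colq: "i < card {i. j < ?q i} \<longleftrightarrow> j < ?q i" for i by (rule less_card_column_iff[OF q])
  have "finite {i. j < ?p i}"
  proof (rule finite_subset)
    show "{i. j < ?p i} \<subseteq> {..<card {i. j < ?p i}}" using colp by blast
  qed simp
  then have finA: "finite ?A" by (rule finite_subset[OF Ap])
  have "a \<in> ?A" if b: "b \<in> ?A" and ab: "a < b" for a b
  proof (cases "j < ?q a")
    case False
    then have "\<not> j < ?q b" using shape_le[OF q, of a b] ab by simp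
    then have b': "(b, j) \<in> skew_cells ?p ?q" "U (b, j) < t" using b by (auto simp: rows_before_def)
    then have a': "(a, j) \<in> skew_cells ?p ?q"
      using False shape_le[OF p, of a b] ab by (auto simp: skew_cells_def)
    show ?thesis
      using flagged_tableauxD(2)[OF U a' b'(1) ab] a' b' by (simp add: rows_before_def)
  qed (simp add: rows_before_def)
  then have cA: "i < card ?A \<longleftrightarrow> i \<in> ?A" for i
    by (intro less_card_down_closed_iff[OF finA]) blast
  have le_p: "card ?A \<le> card {i. j < ?p i}"
    using cA[of "card {i. j < ?p i}"] colp[of "card {i. j < ?p i}"] Ap by force
  have ge_q: "card {i. j < ?q i} \<le> card ?A"
    using cA[of "card ?A"] colq[of "card ?A"] by (force simp: rows_before_def)
  show ?thesis
    unfolding insertion_row_def part_conj_partition[OF la] part_conj_partition[OF mu]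
  proof (rule the_equality)
    have "(a \<le> card ?A \<longrightarrow> T (a, Suc j) < Suc t) \<and> (card ?A < a \<longrightarrow> Suc t < T (a, Suc j))"
      if a: "(a, Suc j) \<in> skew_diagram la mu" for a
    proof -
      obtain i where i: "a = Suc i" "(i, j) \<in> skew_cells ?p ?q"
        using a by (auto simp: skew_diagram_iff)
      have "i \<in> ?A \<longleftrightarrow> U (i, j) < t" using i by (auto simp: rows_before_def skew_cells_def)
      then show ?thesis using i val[OF i(2)] ne[OF i(2)] cA[of i] by auto
    qed
    then show "card {i. j < ?q i} \<le> card ?A \<and> card ?A \<le> card {i. j < ?p i} \<and>
        (\<forall>i'. (i', Suc j) \<in> skew_diagram la mu \<longrightarrow>
          (i' \<le> card ?A \<longrightarrow> T (i', Suc j) < Suc t) \<and> (card ?A < i' \<longrightarrow> Suc t < T (i', Suc j)))"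
      using le_p ge_q by blast
  next
    fix k
    assume "card {i. j < ?q i} \<le> k \<and> k \<le> card {i. j < ?p i} \<and>
        (\<forall>i'. (i', Suc j) \<in> skew_diagram la mu \<longrightarrow>
          (i' \<le> k \<longrightarrow> T (i', Suc j) < Suc t) \<and> (k < i' \<longrightarrow> Suc t < T (i', Suc j)))"
    then have k: "card {i. j < ?q i} \<le> k" "k \<le> card {i. j < ?p i}"
      and below: "\<And>i. (i, j) \<in> skew_cells ?p ?q \<Longrightarrow> Suc i \<le> k \<Longrightarrow> T (Suc i, Suc j) < Suc t"
      and above: "\<And>i. (i, j) \<in> skew_cells ?p ?q \<Longrightarrow> k < Suc i \<Longrightarrow> Suc t < T (Suc i, Suc j)"
      by (auto simp: skew_diagram_iff)
    show "k = card ?A"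
    proof (rule antisym)
      show "k \<le> card ?A"
      proof (rule ccontr)
        assume "\<not> k \<le> card ?A"
        then have "card ?A < card {i. j < ?p i}" "Suc (card ?A) \<le> k" using k by auto
        moreover have "card ?A \<notin> ?A" using cA by blast
        ultimately have "(card ?A, j) \<in> skew_cells ?p ?q" "\<not> U (card ?A, j) < t"
          using colp[of "card ?A"] by (auto simp: rows_before_def skew_cells_def)
        then show False using below[of "card ?A"] val \<open>Suc (card ?A) \<le> k\<close> by simp
      qed
      show "card ?A \<le> k"
      proof (rule ccontr)
        assume "\<not> card ?A \<le> k"
        then have "k \<in> ?A" using cA[of k] by simp
        moreover have "\<not> j < ?q k" using colq[of k] k by simp
        ultimately have "(k, j) \<in> skew_cells ?p ?q" "U (k, j) < t" by (auto simp: rows_before_def)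
        then show False using above[of k] val by simp
      qed
    qed
  qed
qed

lemma sum_SF_eq_shifted_schur:
  "(\<Sum>T\<in>SF la mu. \<Prod>(j, t)\<in>missing la mu T.
      int (part la t) - int t + int (insertion_row la mu T j t) - int j + 1) =
    shifted_schur (length la) (row_length la) (row_length mu)"
proof -
  let ?p = "row_length la" and ?q = "row_length mu"
  let ?down = "\<lambda>T. \<lambda>(i, j)\<in>skew_cells ?p ?q. T (Suc i, Suc j) - Suc 0"
  let ?up = "\<lambda>U. \<lambda>(a, b)\<in>skew_diagram la mu. Suc (U (a - Suc 0, b - Suc 0))"
  have "(\<Sum>T\<in>SF la mu. \<Prod>(j, t)\<in>missing la mu T.
      int (part la t) - int t + int (insertion_row la mu T j t) - int j + 1) =
    (\<Sum>U\<in>flagged_tableaux ?p ?q. tableau_weight ?p ?q U)"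
  proof (rule sum.reindex_bij_witness[where i = ?up and j = ?down])
    fix T assume T: "T \<in> SF la mu"
    have T': "T \<in> skew_diagram la mu \<rightarrow>\<^sub>E {1..}" using T by (simp add: SF_def SSYT_def)
    show "?down T \<in> flagged_tableaux ?p ?q" using down_shift_flagged[OF T] by simp
    show "?up (?down T) = T"
    proof
      fix u :: "nat \<times> nat"
      obtain a b where u: "u = (a, b)" by (cases u)
      show "?up (?down T) u = T u"
      proof (cases "u \<in> skew_diagram la mu")
        case True
        then obtain i j where "a = Suc i" "b = Suc j" "(i, j) \<in> skew_cells ?p ?q"
          using u skew_diagram_iff by blast
        then show ?thesis using PiE_mem[OF T' True] True u by simp
      next
        case False
        then show ?thesis using PiE_arb[OF T' False] u by simp
      qed
    qed
    have "tableau_weight ?p ?q (?down T) =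
        (\<Prod>(j, t)\<in>missing_entries ?p ?q (?down T).
          int (part la (Suc t)) - int (Suc t) + int (insertion_row la mu T (Suc j) (Suc t)) -
          int (Suc j) + 1)"
      unfolding tableau_weight_def
    proof (rule prod.cong[OF refl], safe)
      fix j t assume "(j, t) \<in> missing_entries ?p ?q (?down T)"
      then have "insertion_row la mu T (Suc j) (Suc t) = card (rows_before ?p ?q (?down T) j t)"
        using insertion_row_eq[OF T, of j t] by simp
      then show "int (?p t) - int t + int (card (rows_before ?p ?q (?down T) j t)) - int j - 1 =
          int (part la (Suc t)) - int (Suc t) + int (insertion_row la mu T (Suc j) (Suc t)) -
          int (Suc j) + 1"
        by (simp add: row_length_def)
    qed
    also have "\<dots> = (\<Prod>(j, t)\<in>missing la mu T.
        int (part la t) - int t + int (insertion_row la mu T j t) - int j + 1)"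
    proof -
      have eq: "missing la mu T = shift_cell ` missing_entries ?p ?q (?down T)"
        using missing_shift[OF T] by simp
      show ?thesis
        unfolding eq
        by (subst prod.reindex[OF inj_on_subset[OF inj_shift_cell subset_UNIV]])
          (auto simp: split_beta shift_cell_def intro!: prod.cong)
    qed
    finally show "tableau_weight ?p ?q (?down T) = (\<Prod>(j, t)\<in>missing la mu T.
        int (part la t) - int t + int (insertion_row la mu T j t) - int j + 1)" .
  next
    fix U assume U: "U \<in> flagged_tableaux ?p ?q"
    show "?up U \<in> SF la mu" using up_shift_SF[OF U] by simp
    show "?down (?up U) = U"
    proof
      fix u :: "nat \<times> nat"
      obtain i j where u: "u = (i, j)" by (cases u)
      show "?down (?up U) u = U u"
        using flagged_tableauxD(4)[OF U, of i j] u
        by (cases "(i, j) \<in> skew_cells ?p ?q") (auto simp: skew_diagram_iff)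
    qed
  qed
  also have "\<dots> = shifted_schur (length la) ?p ?q"
    by (rule sum_tableau_weight_eq_shifted_schur[OF shape_row_length[OF la] shape_inner
          row_length_mono])
  finally show ?thesis .
qed

end

lemma hook_length_eq:
  assumes la: "is_partition la" and ij: "j < row_length la i"
  shows "int (hook_length la (Suc i, Suc j)) =
    int (row_length la i) - int i + int (card {k. j < row_length la k}) - int j - 1"
proof -
  let ?c = "card {k. j < row_length la k}"
  have c: "k < ?c \<longleftrightarrow> j < row_length la k" for k
    by (rule less_card_column_iff[OF shape_row_length[OF la]])
  let ?arm = "Pair (Suc i) ` {Suc j..row_length la i}"
  let ?leg = "(\<lambda>a. (a, Suc j)) ` {Suc (Suc i)..?c}"
  have "hook la (Suc i, Suc j) = ?arm \<union> ?leg"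
  proof (rule set_eqI)
    fix u :: "nat \<times> nat"
    obtain a b where u: "u = (a, b)" by (cases u)
    show "u \<in> hook la (Suc i, Suc j) \<longleftrightarrow> u \<in> ?arm \<union> ?leg"
      using u ij c[of "a - 1"] by (cases a; cases b) (auto simp: hook_def diagram_iff Suc_le_eq image_iff)
  qed
  moreover have "?arm \<inter> ?leg = {}" by auto
  ultimately have "hook_length la (Suc i, Suc j) = card ?arm + card ?leg"
    by (simp add: hook_length_def card_Un_disjoint)
  also have "card ?arm = row_length la i - j"
    by (subst card_image) (auto simp: inj_on_def)
  also have "card ?leg = ?c - Suc i"
    by (subst card_image) (auto simp: inj_on_def)
  finally show ?thesis using ij c[of i] by (simp add: of_nat_diff)
qed

text \<open>
  For equal shapes the empty tableau is the only one and misses every entry. The pair \<open>(j, t)\<close> has the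
  factor \<open>p t - t + c - j - 1\<close>, where \<open>c\<close> is the length of column \<open>j\<close>, and this is the hook length of the
  cell in row \<open>t\<close> and column \<open>j\<close>.
\<close>

lemma shifted_schur_self_eq_hook_product:
  assumes la: "is_partition la"
  shows "shifted_schur (length la) (row_length la) (row_length la) =
    (\<Prod>u\<in>diagram la. int (hook_length la u))"
proof -
  let ?p = "row_length la"
  let ?U = "\<lambda>_::nat \<times> nat. undefined :: nat"
  let ?f = "\<lambda>(j, t). (Suc t, Suc j)"
  have cells: "skew_cells ?p ?p = {}" by (auto simp: skew_cells_def)
  then have "flagged_tableaux ?p ?p = {?U}"
    by (simp add: flagged_tableaux_def rows_weakly_increasing_def cols_strictly_increasing_def)
  then have "shifted_schur (length la) ?p ?p = tableau_weight ?p ?p ?U"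
    using sum_tableau_weight_eq_shifted_schur[OF shape_row_length[OF la] shape_row_length[OF la]]
    by simp
  also have "\<dots> = (\<Prod>(j, t) | j < ?p t. int (hook_length la (Suc t, Suc j)))"
    unfolding tableau_weight_def missing_entries_def rows_before_def
    by (rule prod.cong) (auto simp: cells hook_length_eq[OF la])
  also have "\<dots> = (\<Prod>u\<in>?f ` {(j, t). j < ?p t}. int (hook_length la u))"
    by (subst prod.reindex) (auto simp: inj_on_def split_beta)
  also have "?f ` {(j, t). j < ?p t} = diagram la"
    by (rule set_eqI) (force simp: diagram_iff)
  finally show ?thesis .
qed

lemma hook_length_pos:
  assumes "is_partition la" "u \<in> diagram la"
  shows "0 < hook_length la u"
proof -
  have fin: "finite (diagram la)"
  proof (rule finite_subset)
    show "diagram la \<subseteq> shift_cell ` skew_cells (row_length la) (\<lambda>_. 0)"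
      by (force simp: diagram_iff skew_cells_def shift_cell_def)
    show "finite (shift_cell ` skew_cells (row_length la) (\<lambda>_. 0))"
      by (intro finite_imageI finite_skew_cells[OF shape_row_length[OF assms(1)]])
  qed
  have "hook la u \<subseteq> diagram la" by (auto simp: hook_def split: prod.splits)
  then have "finite (hook la u)" by (rule finite_subset) (rule fin)
  moreover have "u \<in> hook la u" using assms(2) by (auto simp: hook_def split: prod.splits)
  ultimately show ?thesis unfolding hook_length_def by (metis card_gt_0_iff empty_iff)
qed

theorem corollary5p7:
  fixes la mu :: "nat list" and d :: nat
  assumes "is_partition la" and "d = length la"
    and "is_partition mu"
    and "diagram mu \<subseteq> diagram la"
  shows "(of_nat (num_SYT la mu) :: rat) =
    fact (card (skew_diagram la mu)) / (\<Prod>u\<in>diagram la. of_nat (hook_length la u)) *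
    (\<Sum>T\<in>SF la mu. \<Prod>(j, t)\<in>missing la mu T.
       of_int (int (part la t) - int t + int (insertion_row la mu T j t) - int j + 1))"
proof -
  let ?p = "row_length la" and ?q = "row_length mu"
  let ?H = "\<Prod>u\<in>diagram la. of_nat (hook_length la u) :: rat"
  let ?S = "\<Sum>T\<in>SF la mu. \<Prod>(j, t)\<in>missing la mu T.
    int (part la t) - int t + int (insertion_row la mu T j t) - int j + 1"
  have "num_SYT la mu = card (standard_fillings (shift_cell ` skew_cells ?p ?q))"
    by (simp add: num_SYT_def SYT_def standard_fillings_def skew_diagram_eq)
  moreover have "card (skew_diagram la mu) = card (skew_cells ?p ?q)"
    unfolding skew_diagram_eq by (rule card_image[OF inj_on_subset[OF inj_shift_cell]]) simp
  ultimately have "int (num_SYT la mu) * (\<Prod>u\<in>diagram la. int (hook_length la u)) =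
      fact (card (skew_diagram la mu)) * ?S"
    using card_standard_fillings_shifted_schur[OF shape_row_length[OF assms(1)]
        shape_inner[OF assms(1,3,4)] row_length_mono[OF assms(1,3,4)]]
    unfolding shifted_schur_self_eq_hook_product[OF assms(1)] sum_SF_eq_shifted_schur[OF assms(1,3,4)]
    by simp
  then have "(of_int (int (num_SYT la mu) * (\<Prod>u\<in>diagram la. int (hook_length la u))) :: rat) =
      of_int (fact (card (skew_diagram la mu)) * ?S)"
    by (rule arg_cong)
  then have "of_nat (num_SYT la mu) * ?H = fact (card (skew_diagram la mu)) * of_int ?S"
    by simp
  moreover have "?H \<noteq> 0"
  proof -
    have "hook_length la u \<noteq> 0" if "u \<in> diagram la" for u
      using hook_length_pos[OF assms(1) that] by simp
    then show ?thesis by (cases "finite (diagram la)") auto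
  qed
  ultimately have "of_nat (num_SYT la mu) = fact (card (skew_diagram la mu)) / ?H * of_int ?S"
    by (simp add: field_simps)
  then show ?thesis by (simp add: split_beta)
qed
end
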